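(* Let $\mathbb{F}$ be a finitely generated free group, $V$ a finite set, $\mathcal{L}:V\to\mathbb{F}$ a map, $\Pi=(\Pi_{v,w})_{v,w\in V}$ a stochastic matrix, and $\nu$ a stationary distribution of $\Pi$ with $\nu(v)>0$ for all $v\in V$. Let $k\ge 1$ and suppose $\Pi$ is admissible of order $k$. Then for any probability-measure-preserving action $\mathbb{F}\curvearrowright (X,\mu)$ and any $f\in L^1(X,\mu)$, $$\frac{1}{2k}\sum_{i=0}^{2k-1} S_{n+i}f$$ converges in $L^1(X,\mu)$ to $\mathbb{E}[f|\mathbb{F}]$ as $n\to\infty$, where $\mathbb{E}[f|\mathbb{F}]$ is the conditional expectation of $f$ on the sigma-algebra of $\mathbb{F}$-invariant measurable subsets of $X$.
   Context: Stochastic means $\Pi_{v,w}\ge 0$ and $\sum_{w}\Pi_{v,w}=1$ for every $v\in V$. A stationary distribution is a probability distribution $\nu:V\to[0,1]$ with $\sum_{v\in V}\nu(v)\Pi_{v,w}=\nu(w)$ for every $w\in V$. The directed graph associated with $\Pi$ is $G=(V,E)$ with $E=\{(w,v)\in V\times V:\ \Pi_{v,w}>0\}$ (note the reversed order). A directed path in $G$ of length $n$ is a sequence $s=(s_1,\dots,s_n)\in V^n$ with $(s_i,s_{i+1})\in E$ for $1\le i<n$. For $s=(s_1,\dots,s_n)\in V^n$ put $\mathcal{L}(s)=\mathcal{L}(s_1)\cdots\mathcal{L}(s_n)\in\mathbb{F}$ and $\Pi_s=\Pi_{s_n,s_{n-1}}\cdots\Pi_{s_2,s_1}$ (equal to $1$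 if $n=1$). Juxtaposition of paths and vertices denotes concatenation of sequences. A probability-measure-preserving action $\mathbb{F}\curvearrowright(X,\mu)$ is a homomorphism $T:\mathbb{F}\to \mathrm{Aut}(X,\mu)$, $g\mapsto T_g$, into the group of measure-preserving transformations of the probability space $(X,\mu)$. Write $T_s=T_{\mathcal{L}(s)}$. The spherical averages $S_n:L^1(X,\mu)\to L^1(X,\mu)$ are $$S_n(\phi)(x)=\sum_{s=(s_1,\dots,s_n)\in V^n}\nu(s_n)\,\Pi_s\,\phi(T_s x).$$ $G$ contains a good subgraph of order $k$ if there are vertices $u,w\in V$ and directed paths $p,q,p^*,q^*$ of length $k$ (elements of $V^k$) such that $upw$, $uqw$, $pq^*p$, $qp^*q$ are directed paths in $G$, and $\mathcal{L}(p^* )=\mathcal{L}(p)^{-1}$, $\mathcal{L}(q^* )=\mathcal{L}(q)^{-1}$. For $v\in V$, $\Gamma_v\le\mathbb{F}$ is the subgroup generated by all $\mathcal{L}(p)$ where $p=(p_1,\dots,p_n)$ ($n\ge1$) is a directed path in $G$ with $p_1=v$ and $(p_n,v)\in E$. $\Pi$ is admissible of order $k$ if $G$ contains a good subgraph of order $k$, $G$ is strongly connected, and there is some $v\in V$ with $\Gamma_v=\mathbb{F}$. *)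

theory Defs
  imports
    "HOL-Probability.Probability"
    "HOL-Algebra.Bij"
    "HOL-Algebra.Generated_Groups"
begin

section \<open>Free groups\<close>

text \<open>A letter \<open>(b, True)\<close> stands for \<open>b\<close> and \<open>(b, False)\<close> for its inverse.\<close>

definition letter_val :: "('g, 'm) monoid_scheme \<Rightarrow> 'g \<times> bool \<Rightarrow> 'g" where
  "letter_val F l = (if snd l then fst l else inv\<^bsub>F\<^esub> (fst l))"

definition word_val :: "('g, 'm) monoid_scheme \<Rightarrow> ('g \<times> bool) list \<Rightarrow> 'g" where
  "word_val F ls = foldr (\<otimes>\<^bsub>F\<^esub>) (map (letter_val F) ls) \<one>\<^bsub>F\<^esub>"

definition reduced_word :: "('g \<times> bool) list \<Rightarrow> bool" where
  "reduced_word ls \<longleftrightarrow> successively (\<lambda>a b. \<not> (fst a = fst b \<and> snd a \<noteq> snd b)) ls"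

text \<open>\<open>B\<close> is a free basis if every group element is the value of exactly one reduced word
  over \<open>B\<close>.\<close>

definition free_basis :: "('g, 'm) monoid_scheme \<Rightarrow> 'g set \<Rightarrow> bool" where
  "free_basis F B \<longleftrightarrow>
     B \<subseteq> carrier F \<and>
     bij_betw (word_val F) {ls \<in> lists (B \<times> UNIV). reduced_word ls} (carrier F)"

definition free_group :: "('g, 'm) monoid_scheme \<Rightarrow> bool" where
  "free_group F \<longleftrightarrow> group F \<and> (\<exists>B. free_basis F B)"

definition finitely_generated_group :: "('g, 'm) monoid_scheme \<Rightarrow> bool" where
  "finitely_generated_group F \<longleftrightarrow>
     group F \<and> (\<exists>S. finite S \<and> S \<subseteq> carrier F \<and> generate F S = carrier F)"

section \<open>Stochastic matrices and their graphs\<close>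

definition stochastic_matrix :: "'v set \<Rightarrow> ('v \<Rightarrow> 'v \<Rightarrow> real) \<Rightarrow> bool" where
  "stochastic_matrix V P \<longleftrightarrow>
     (\<forall>v\<in>V. \<forall>w\<in>V. P v w \<ge> 0) \<and> (\<forall>v\<in>V. (\<Sum>w\<in>V. P v w) = 1)"

definition stationary_distribution ::
    "'v set \<Rightarrow> ('v \<Rightarrow> 'v \<Rightarrow> real) \<Rightarrow> ('v \<Rightarrow> real) \<Rightarrow> bool" where
  "stationary_distribution V P \<nu> \<longleftrightarrow>
     (\<forall>v\<in>V. \<nu> v \<in> {0..1}) \<and> (\<Sum>v\<in>V. \<nu> v) = 1 \<and>
     (\<forall>w\<in>V. (\<Sum>v\<in>V. \<nu> v * P v w) = \<nu> w)"

text \<open>Edges point against the transitions of the Markov chain.\<close>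

definition edges :: "'v set \<Rightarrow> ('v \<Rightarrow> 'v \<Rightarrow> real) \<Rightarrow> ('v \<times> 'v) set" where
  "edges V P = {(w, v). w \<in> V \<and> v \<in> V \<and> P v w > 0}"

definition directed_path :: "'v set \<Rightarrow> ('v \<Rightarrow> 'v \<Rightarrow> real) \<Rightarrow> 'v list \<Rightarrow> bool" where
  "directed_path V P s \<longleftrightarrow>
     s \<in> lists V \<and> successively (\<lambda>a b. (a, b) \<in> edges V P) s"

definition path_label :: "('g, 'm) monoid_scheme \<Rightarrow> ('v \<Rightarrow> 'g) \<Rightarrow> 'v list \<Rightarrow> 'g" where
  "path_label F L s = foldr (\<otimes>\<^bsub>F\<^esub>) (map L s) \<one>\<^bsub>F\<^esub>"

definition path_weight :: "('v \<Rightarrow> 'v \<Rightarrow> real) \<Rightarrow> 'v list \<Rightarrow> real" where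
  "path_weight P s = (\<Prod>i<length s - 1. P (s ! Suc i) (s ! i))"

definition strongly_connected_graph :: "'v set \<Rightarrow> ('v \<Rightarrow> 'v \<Rightarrow> real) \<Rightarrow> bool" where
  "strongly_connected_graph V P \<longleftrightarrow> (\<forall>u\<in>V. \<forall>w\<in>V. (u, w) \<in> (edges V P)\<^sup>*)"

definition good_subgraph ::
    "('g, 'm) monoid_scheme \<Rightarrow> 'v set \<Rightarrow> ('v \<Rightarrow> 'g) \<Rightarrow> ('v \<Rightarrow> 'v \<Rightarrow> real) \<Rightarrow> nat \<Rightarrow> bool" where
  "good_subgraph F V L P k \<longleftrightarrow>
     (\<exists>u\<in>V. \<exists>w\<in>V. \<exists>p q p' q'.
        directed_path V P p \<and> directed_path V P q \<and>
        directed_path V P p' \<and> directed_path V P q' \<and>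
        length p = k \<and> length q = k \<and> length p' = k \<and> length q' = k \<and>
        directed_path V P ([u] @ p @ [w]) \<and> directed_path V P ([u] @ q @ [w]) \<and>
        directed_path V P (p @ q' @ p) \<and> directed_path V P (q @ p' @ q) \<and>
        path_label F L p' = inv\<^bsub>F\<^esub> (path_label F L p) \<and>
        path_label F L q' = inv\<^bsub>F\<^esub> (path_label F L q))"

definition loop_group ::
    "('g, 'm) monoid_scheme \<Rightarrow> 'v set \<Rightarrow> ('v \<Rightarrow> 'g) \<Rightarrow> ('v \<Rightarrow> 'v \<Rightarrow> real) \<Rightarrow> 'v \<Rightarrow> 'g set" where
  "loop_group F V L P v =
     generate F (path_label F L `
       {p. p \<noteq> [] \<and> directed_path V P p \<and> hd p = v \<and> (last p, v) \<in> edges V P})"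

definition admissible ::
    "('g, 'm) monoid_scheme \<Rightarrow> 'v set \<Rightarrow> ('v \<Rightarrow> 'g) \<Rightarrow> ('v \<Rightarrow> 'v \<Rightarrow> real) \<Rightarrow> nat \<Rightarrow> bool" where
  "admissible F V L P k \<longleftrightarrow>
     good_subgraph F V L P k \<and> strongly_connected_graph V P \<and>
     (\<exists>v\<in>V. loop_group F V L P v = carrier F)"

section \<open>Measure-preserving actions and spherical averages\<close>

text \<open>Multiplication is composition of maps on \<open>space M\<close>, inherited from \<^const>\<open>BijGroup\<close>,
  whose elements are the bijections that are \<open>undefined\<close> off \<open>space M\<close>.\<close>

definition measure_aut_group :: "'x measure \<Rightarrow> ('x \<Rightarrow> 'x) monoid" where
  "measure_aut_group M = (BijGroup (space M))
     \<lparr>carrier := {h \<in> Bij (space M).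
        h \<in> M \<rightarrow>\<^sub>M M \<and> inv_into (space M) h \<in> M \<rightarrow>\<^sub>M M \<and> distr M M h = M}\<rparr>"

definition pmp_action ::
    "('g, 'm) monoid_scheme \<Rightarrow> 'x measure \<Rightarrow> ('g \<Rightarrow> 'x \<Rightarrow> 'x) \<Rightarrow> bool" where
  "pmp_action F M T \<longleftrightarrow> prob_space M \<and> T \<in> hom F (measure_aut_group M)"

text \<open>Meaningful for \<open>n \<ge> 1\<close> only, since \<open>last []\<close> is unspecified.\<close>

definition spherical_average ::
    "('g, 'm) monoid_scheme \<Rightarrow> 'v set \<Rightarrow> ('v \<Rightarrow> 'g) \<Rightarrow> ('v \<Rightarrow> 'v \<Rightarrow> real) \<Rightarrow> ('v \<Rightarrow> real) \<Rightarrow>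
     ('g \<Rightarrow> 'x \<Rightarrow> 'x) \<Rightarrow> nat \<Rightarrow> ('x \<Rightarrow> real) \<Rightarrow> 'x \<Rightarrow> real" where
  "spherical_average F V L P \<nu> T n \<phi> x =
     (\<Sum>s | s \<in> lists V \<and> length s = n.
        \<nu> (last s) * path_weight P s * \<phi> (T (path_label F L s) x))"

text \<open>Only the underlying \<open>\<sigma>\<close>-algebra matters; as a measure this is zero.\<close>

definition invariant_algebra ::
    "('g, 'm) monoid_scheme \<Rightarrow> 'x measure \<Rightarrow> ('g \<Rightarrow> 'x \<Rightarrow> 'x) \<Rightarrow> 'x measure" where
  "invariant_algebra F M T =
     sigma (space M) {A \<in> sets M. \<forall>g\<in>carrier F. T g -` A \<inter> space M = A}"

lemma
  assumes "pmp_action F M T"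
  shows sets_invariant_algebra:
      "sets (invariant_algebra F M T) =
         {A \<in> sets M. \<forall>g\<in>carrier F. T g -` A \<inter> space M = A}"
    and subalgebra_invariant_algebra: "subalgebra M (invariant_algebra F M T)"
proof -
  let ?I = "{A \<in> sets M. \<forall>g\<in>carrier F. T g -` A \<inter> space M = A}"
  have T: "T g \<in> M \<rightarrow>\<^sub>M M" if "g \<in> carrier F" for g
    using assms that by (auto simp: pmp_action_def hom_def measure_aut_group_def)
  have "sigma_algebra (space M) ?I"
    unfolding sigma_algebra_iff2
  proof (intro conjI ballI allI impI)
    show "?I \<subseteq> Pow (space M)"
      using sets.sets_into_space by blast
    show "{} \<in> ?I"
      by auto
    fix A assume A: "A \<in> ?I"
    have "T g -` (space M - A) \<inter> space M = space M - A" if g: "g \<in> carrier F" for g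
    proof -
      have "T g -` (space M - A) \<inter> space M = space M - (T g -` A \<inter> space M)"
        using measurable_space[OF T[OF g]] by auto
      with A g show ?thesis by auto
    qed
    with A show "space M - A \<in> ?I"
      by auto
  next
    fix A :: "nat \<Rightarrow> _" assume A: "range A \<subseteq> ?I"
    have "T g -` (\<Union>i. A i) \<inter> space M = (\<Union>i. A i)" if g: "g \<in> carrier F" for g
    proof -
      have "T g -` (\<Union>i. A i) \<inter> space M = (\<Union>i. T g -` A i \<inter> space M)"
        by auto
      also have "\<dots> = (\<Union>i. A i)"
        using A g by (intro SUP_cong) auto
      finally show ?thesis .
    qed
    with A show "(\<Union>i. A i) \<in> ?I"
      by auto
  qed
  then show eq: "sets (invariant_algebra F M T) = ?I"
    unfolding invariant_algebra_def
    using sigma_algebra.sigma_sets_eq sigma_algebra_iff2 by (metis (no_types, lifting) sets_measure_of)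
  show "subalgebra M (invariant_algebra F M T)"
    unfolding subalgebra_def eq
    by (auto simp: invariant_algebra_def space_measure_of_conv)
qed

end

theory Submission
  imports Defs
begin

text \<open>
  Let \<open>\<tau> v = T (L v)\<close> and let \<open>markov\<close> be the operator that sends a function \<open>\<psi>\<close> on \<open>V \<times> X\<close> to
  \<open>\<lambda>v x. \<Sum>w\<in>V. P v w * \<psi> w (\<tau> w x)\<close>. It is the transition operator of the chain that jumps from
  \<open>(v, x)\<close> to \<open>(w, \<tau> w x)\<close> with probability \<open>P v w\<close>, and it preserves the product of \<open>\<nu>\<close> with the
  invariant measure. Reading the vertices of a path from last to first shows that the spherical
  average \<open>S n f\<close> is the \<open>\<nu>\<close>-mean over \<open>v\<close> of \<open>markov ^^ n\<close> applied to \<open>f\<close>.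

  The operator contracts the square norm, and the loss of norm in one application is a weighted
  sum of the squared distances between \<open>\<psi> w (\<tau> w x)\<close> and \<open>markov \<psi> v x\<close> (\<open>norm_sq_markov\<close>).
  Along an orbit \<open>\<psi>\<^sub>n = (markov ^^ n) \<psi>\<close> the norms converge, so these losses tend to zero: for every
  edge \<open>(w, v)\<close> the functions \<open>\<psi>\<^sub>n\<^sub>+\<^sub>1 v\<close> and \<open>\<psi>\<^sub>n w \<circ> \<tau> w\<close> become equal in square mean. Chaining
  edges, a path \<open>s\<close> followed by \<open>v\<close> and starting at \<open>u\<close> makes \<open>\<psi>\<^sub>n\<^sub>+\<^sub>j v\<close>, where \<open>j\<close> is the length of
  \<open>s\<close>, asymptotic to \<open>\<psi>\<^sub>n u \<circ> T\<^sub>s\<close> (\<open>L2_asymptotic_orbit_path\<close>). So asymptotically the random walk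
  forgets which of the allowed paths it has taken, and the rest of the argument exploits this.

  A good subgraph forces asymptotic period \<open>2 * k\<close> (\<open>L2_asymptotic_orbit_period\<close>). Write \<open>p\<^sub>1\<close>, \<open>q\<^sub>1\<close>
  for the first vertices of \<open>p\<close>, \<open>q\<close> and \<open>\<sim>\<close> for asymptotic equality. The edges from \<open>u\<close> give
  \<open>\<psi>\<^sub>n p\<^sub>1 \<sim> \<psi>\<^sub>n q\<^sub>1\<close>. The common end \<open>w\<close> of \<open>p\<close> and \<open>q\<close> gives \<open>\<psi>\<^sub>n p\<^sub>1 \<circ> T\<^sub>p \<sim> \<psi>\<^sub>n q\<^sub>1 \<circ> T\<^sub>q\<close>. The
  path from \<open>p\<^sub>1\<close> to \<open>p\<^sub>1\<close> through \<open>p\<close> and \<open>q\<^sup>*\<close> gives \<open>\<psi>\<^sub>n\<^sub>+\<^sub>2\<^sub>k p\<^sub>1 \<sim> \<psi>\<^sub>n p\<^sub>1 \<circ> T\<^sub>p \<circ> T\<^sub>q\<^sup>-\<^sup>1\<close>, hence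
  \<open>\<psi>\<^sub>n\<^sub>+\<^sub>2\<^sub>k p\<^sub>1 \<sim> \<psi>\<^sub>n q\<^sub>1 \<sim> \<psi>\<^sub>n p\<^sub>1\<close>, and strong connectedness spreads this to all vertices.

  Averaging over a window of length \<open>2 * k\<close> therefore yields an orbit \<open>a\<^sub>n\<close> with \<open>a\<^sub>n\<^sub>+\<^sub>1 \<sim> a\<^sub>n\<close>. Such
  an orbit is Cauchy (\<open>norm_sq_orbit_dist\<close>): if \<open>d\<close> is the limit of \<open>\<parallel>a\<^sub>n\<parallel>\<^sup>2\<close>, then \<open>a\<^sub>m + a\<^sub>n\<close> is driven by
  the contraction \<open>markov\<close> to norm square \<open>4 * d\<close>, so \<open>4 * d \<le> \<parallel>a\<^sub>m + a\<^sub>n\<parallel>\<^sup>2\<close>, and the parallelogram law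
  bounds \<open>\<parallel>a\<^sub>m - a\<^sub>n\<parallel>\<^sup>2\<close>. Loops at a vertex show that the limit is invariant under the loop group,
  which is the whole group at a suitable vertex; and integrals over invariant sets do not change
  along the orbit. These two facts identify the limit with the conditional expectation
  (\<open>bounded_window_converges\<close>).

  This argument takes place among bounded functions. All integrable functions are reached by
  truncation, since the averages and the conditional expectation contract the \<open>L\<^sup>1\<close>-distance.
\<close>

section \<open>Asymptotic equality in square mean\<close>

lemma tendsto_0_le_ennreal:
  fixes u w :: "nat \<Rightarrow> ennreal"
  assumes "\<And>n. u n \<le> w n" "w \<longlonglongrightarrow> 0"
  shows "u \<longlonglongrightarrow> 0"
  by (rule tendsto_sandwich[OF _ _ tendsto_const assms(2)]) (simp_all add: assms(1))

lemma ennreal_real_between: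
  fixes e :: ennreal
  assumes "0 < e"
  obtains d :: real where "0 < d" "ennreal d < e"
proof -
  obtain c where c: "0 < c" "c < e"
    using dense[OF assms] by blast
  then obtain d where d: "0 \<le> d" "c = ennreal d"
    by (cases c) auto
  show ?thesis
    by (rule that[of d]) (use c d in simp_all)
qed

text \<open>Measurability is part of the relation, so that symmetry, transitivity and composition with
  measure-preserving maps need no side conditions on the sequences. The integral takes values in \<open>ennreal\<close>, so that
  integrability need not be tracked either.\<close>

definition L2_asymptotic :: "'x measure \<Rightarrow> (nat \<Rightarrow> 'x \<Rightarrow> real) \<Rightarrow> (nat \<Rightarrow> 'x \<Rightarrow> real) \<Rightarrow> bool" where
  "L2_asymptotic M a b \<longleftrightarrow>
     (\<forall>n. a n \<in> borel_measurable M) \<and> (\<forall>n. b n \<in> borel_measurable M) \<and>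
     (\<lambda>n. \<integral>\<^sup>+ x. ennreal ((a n x - b n x)\<^sup>2) \<partial>M) \<longlonglongrightarrow> 0"

lemma L2_asymptotic_refl:
  "(\<And>n. a n \<in> borel_measurable M) \<Longrightarrow> L2_asymptotic M a a"
  by (simp add: L2_asymptotic_def)

lemma L2_asymptotic_sym: "L2_asymptotic M a b \<Longrightarrow> L2_asymptotic M b a"
  by (simp add: L2_asymptotic_def power2_commute)

lemma L2_asymptotic_trans:
  assumes "L2_asymptotic M a b" "L2_asymptotic M b c"
  shows "L2_asymptotic M a c"
proof -
  have [measurable]: "\<And>n. a n \<in> borel_measurable M" "\<And>n. b n \<in> borel_measurable M"
    "\<And>n. c n \<in> borel_measurable M"
    using assms by (auto simp: L2_asymptotic_def)
  let ?I = "\<lambda>u v n. \<integral>\<^sup>+ x. ennreal ((u n x - v n x)\<^sup>2) \<partial>M"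
  have le: "?I a c n \<le> 2 * ?I a b n + 2 * ?I b c n" for n
  proof -
    have "?I a c n \<le> (\<integral>\<^sup>+ x. 2 * ennreal ((a n x - b n x)\<^sup>2) + 2 * ennreal ((b n x - c n x)\<^sup>2) \<partial>M)"
    proof (rule nn_integral_mono)
      fix x
      have "(a n x - c n x)\<^sup>2 \<le> 2 * (a n x - b n x)\<^sup>2 + 2 * (b n x - c n x)\<^sup>2"
        using zero_le_power2[of "(a n x - b n x) - (b n x - c n x)"]
        by (simp add: power2_eq_square algebra_simps)
      then have "ennreal ((a n x - c n x)\<^sup>2) \<le> ennreal (2 * (a n x - b n x)\<^sup>2 + 2 * (b n x - c n x)\<^sup>2)"
        by (rule ennreal_leI)
      then show "ennreal ((a n x - c n x)\<^sup>2) \<le> 2 * ennreal ((a n x - b n x)\<^sup>2) + 2 * ennreal ((b n x - c n x)\<^sup>2)"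
        by (simp add: ennreal_plus ennreal_mult)
    qed
    also have "\<dots> = 2 * ?I a b n + 2 * ?I b c n"
      by (simp add: nn_integral_add nn_integral_cmult)
    finally show ?thesis .
  qed
  have "(\<lambda>n. 2 * ?I a b n + 2 * ?I b c n) \<longlonglongrightarrow> 2 * 0 + 2 * 0"
    using assms unfolding L2_asymptotic_def
    by (intro tendsto_add ennreal_tendsto_cmult) auto
  then have "(\<lambda>n. 2 * ?I a b n + 2 * ?I b c n) \<longlonglongrightarrow> 0"
    by simp
  from tendsto_0_le_ennreal[OF le this] show ?thesis
    by (simp add: L2_asymptotic_def)
qed

lemma L2_asymptotic_cong:
  assumes "L2_asymptotic M a b"
    and "\<And>n x. x \<in> space M \<Longrightarrow> a n x = a' n x" "\<And>n x. x \<in> space M \<Longrightarrow> b n x = b' n x"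
  shows "L2_asymptotic M a' b'"
proof -
  have "(\<integral>\<^sup>+ x. ennreal ((a n x - b n x)\<^sup>2) \<partial>M) = (\<integral>\<^sup>+ x. ennreal ((a' n x - b' n x)\<^sup>2) \<partial>M)" for n
    using assms(2,3) by (intro nn_integral_cong) auto
  moreover have "a n \<in> borel_measurable M \<longleftrightarrow> a' n \<in> borel_measurable M"
    "b n \<in> borel_measurable M \<longleftrightarrow> b' n \<in> borel_measurable M" for n
    using assms(2,3) by (auto intro!: measurable_cong)
  ultimately show ?thesis
    using assms(1) by (simp add: L2_asymptotic_def)
qed

lemma L2_asymptotic_compose:
  assumes "L2_asymptotic M a b" and h [measurable]: "h \<in> M \<rightarrow>\<^sub>M M" and "distr M M h = M"
  shows "L2_asymptotic M (\<lambda>n x. a n (h x)) (\<lambda>n x. b n (h x))"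
proof -
  have [measurable]: "\<And>n. a n \<in> borel_measurable M" "\<And>n. b n \<in> borel_measurable M"
    using assms by (auto simp: L2_asymptotic_def)
  have "(\<integral>\<^sup>+ x. ennreal ((a n (h x) - b n (h x))\<^sup>2) \<partial>M)
      = (\<integral>\<^sup>+ x. ennreal ((a n x - b n x)\<^sup>2) \<partial>(distr M M h))" for n
    by (rule nn_integral_distr[symmetric]) auto
  then show ?thesis
    using assms by (simp add: L2_asymptotic_def)
qed

lemma L2_asymptotic_shift:
  assumes "L2_asymptotic M a b"
  shows "L2_asymptotic M (\<lambda>n. a (n + j)) (\<lambda>n. b (n + j))"
  using assms LIMSEQ_ignore_initial_segment
  unfolding L2_asymptotic_def by blast

text \<open>A statement about a limit may be checked on a tail of the sequences. It lets a relation between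
  delayed orbits, which is what a path provides, be read off for the orbits themselves.\<close>

lemma L2_asymptotic_unshift:
  assumes "L2_asymptotic M (\<lambda>n. a (n + j)) (\<lambda>n. b (n + j))"
    and "\<And>n. a n \<in> borel_measurable M" "\<And>n. b n \<in> borel_measurable M"
  shows "L2_asymptotic M a b"
  using assms LIMSEQ_offset[of "\<lambda>n. \<integral>\<^sup>+ x. ennreal ((a n x - b n x)\<^sup>2) \<partial>M" j 0]
  unfolding L2_asymptotic_def by blast

lemma L2_asymptotic_iterate:
  assumes "L2_asymptotic M (\<lambda>n. a (Suc n)) a"
  shows "L2_asymptotic M (\<lambda>n. a (n + j)) a"
proof (induction j)
  case 0
  show ?case using assms by (auto simp: L2_asymptotic_def)
next
  case (Suc j)
  then show ?case
    using L2_asymptotic_trans[OF L2_asymptotic_shift[OF assms, of j] Suc] by simp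
qed

lemma L2_asymptotic_scaled:
  assumes "L2_asymptotic M a' b'"
    and "\<And>n x. a n x - b n x = c * (a' n x - b' n x)"
    and "\<And>n. a n \<in> borel_measurable M" "\<And>n. b n \<in> borel_measurable M"
  shows "L2_asymptotic M a b"
proof -
  have [measurable]: "\<And>n. a' n \<in> borel_measurable M" "\<And>n. b' n \<in> borel_measurable M"
    and lim: "(\<lambda>n. \<integral>\<^sup>+ x. ennreal ((a' n x - b' n x)\<^sup>2) \<partial>M) \<longlonglongrightarrow> 0"
    using assms(1) by (auto simp: L2_asymptotic_def)
  have "(\<integral>\<^sup>+ x. ennreal ((a n x - b n x)\<^sup>2) \<partial>M)
      = ennreal (c\<^sup>2) * (\<integral>\<^sup>+ x. ennreal ((a' n x - b' n x)\<^sup>2) \<partial>M)" for n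
    by (subst nn_integral_cmult[symmetric]) (auto simp: assms(2) power_mult_distrib ennreal_mult)
  moreover have "(\<lambda>n. ennreal (c\<^sup>2) * (\<integral>\<^sup>+ x. ennreal ((a' n x - b' n x)\<^sup>2) \<partial>M)) \<longlonglongrightarrow> ennreal (c\<^sup>2) * 0"
    using lim by (intro ennreal_tendsto_cmult) auto
  ultimately show ?thesis
    using assms(3,4) by (simp add: L2_asymptotic_def)
qed

lemma L2_asymptotic_const_AE:
  assumes "L2_asymptotic M (\<lambda>_. f) (\<lambda>_. g)"
  shows "AE x in M. f x = g x"
proof -
  have [measurable]: "f \<in> borel_measurable M" "g \<in> borel_measurable M"
    and "(\<lambda>n::nat. \<integral>\<^sup>+ x. ennreal ((f x - g x)\<^sup>2) \<partial>M) \<longlonglongrightarrow> 0"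
    using assms by (auto simp: L2_asymptotic_def)
  then have "(\<integral>\<^sup>+ x. ennreal ((f x - g x)\<^sup>2) \<partial>M) = 0"
    by (simp add: LIMSEQ_const_iff)
  then have "AE x in M. ennreal ((f x - g x)\<^sup>2) = 0"
    by (subst (asm) nn_integral_0_iff_AE) auto
  then show ?thesis
    by eventually_elim auto
qed

text \<open>On a probability space, \<open>t \<le> t\<^sup>2 / d + d / 2\<close> for every \<open>d > 0\<close> replaces the Cauchy-Schwarz
  inequality.\<close>

lemma (in prob_space) L2_asymptotic_imp_L1:
  assumes "L2_asymptotic M a b"
  shows "(\<lambda>n. \<integral>\<^sup>+ x. ennreal \<bar>a n x - b n x\<bar> \<partial>M) \<longlonglongrightarrow> 0"
proof -
  have [measurable]: "\<And>n. a n \<in> borel_measurable M" "\<And>n. b n \<in> borel_measurable M"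
    and lim: "(\<lambda>n. \<integral>\<^sup>+ x. ennreal ((a n x - b n x)\<^sup>2) \<partial>M) \<longlonglongrightarrow> 0"
    using assms by (auto simp: L2_asymptotic_def)
  let ?J = "\<lambda>n. \<integral>\<^sup>+ x. ennreal ((a n x - b n x)\<^sup>2) \<partial>M"
  show ?thesis
  proof (rule order_tendstoI)
    fix e :: ennreal assume "0 < e"
    then obtain d where d: "0 < d" "ennreal d < e"
      by (rule ennreal_real_between)
    have bd: "(\<integral>\<^sup>+ x. ennreal \<bar>a n x - b n x\<bar> \<partial>M) \<le> ennreal (1 / d) * ?J n + ennreal (d / 2)" for n
    proof -
      have "(\<integral>\<^sup>+ x. ennreal \<bar>a n x - b n x\<bar> \<partial>M)
          \<le> (\<integral>\<^sup>+ x. ennreal (1 / d) * ennreal ((a n x - b n x)\<^sup>2) + ennreal (d / 2) \<partial>M)"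
      proof (rule nn_integral_mono)
        fix x
        let ?t = "\<bar>a n x - b n x\<bar>"
        have "0 \<le> (?t - d)\<^sup>2" by simp
        then have "2 * d * ?t \<le> ?t\<^sup>2 + d\<^sup>2"
          by (simp add: power2_diff mult.commute mult.left_commute)
        then have "?t \<le> (1 / d) * ?t\<^sup>2 / 2 + d / 2"
          using d(1) by (simp add: field_simps power2_eq_square)
        also have "\<dots> \<le> (1 / d) * ?t\<^sup>2 + d / 2"
          using d(1) by (simp add: divide_left_mono)
        finally have "ennreal ?t \<le> ennreal ((1 / d) * ?t\<^sup>2 + d / 2)"
          by (rule ennreal_leI)
        then show "ennreal ?t \<le> ennreal (1 / d) * ennreal ((a n x - b n x)\<^sup>2) + ennreal (d / 2)"
          using d(1) by (simp add: ennreal_plus ennreal_mult power2_eq_square[symmetric] del: ennreal_plus)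
            (simp add: ennreal_plus[symmetric] ennreal_mult[symmetric] del: ennreal_plus)
      qed
      also have "\<dots> = ennreal (1 / d) * ?J n + ennreal (d / 2)"
        by (simp add: nn_integral_add nn_integral_cmult emeasure_space_1)
      finally show ?thesis .
    qed
    have "(\<lambda>n. ennreal (1 / d) * ?J n + ennreal (d / 2)) \<longlonglongrightarrow> ennreal (1 / d) * 0 + ennreal (d / 2)"
      using lim by (intro tendsto_add ennreal_tendsto_cmult) auto
    moreover have "ennreal (1 / d) * 0 + ennreal (d / 2) < e"
      using d by (simp add: order_le_less_trans[OF ennreal_leI[of "d/2" d] d(2)])
    ultimately have "\<forall>\<^sub>F n in sequentially. ennreal (1 / d) * ?J n + ennreal (d / 2) < e"
      by (rule order_tendstoD(2))
    then show "\<forall>\<^sub>F n in sequentially. (\<integral>\<^sup>+ x. ennreal \<bar>a n x - b n x\<bar> \<partial>M) < e"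
      by eventually_elim (use bd order_le_less_trans in blast)
  qed auto
qed

text \<open>Completeness of \<open>L\<^sup>2\<close>. A subsequence with squared steps of size \<open>4\<^sup>-\<^sup>j\<close> has integrable total
  variation, so it converges almost everywhere; Fatou's lemma then turns the pointwise limit
  into a limit in square mean of the whole sequence.\<close>

lemma (in prob_space) L2_Cauchy_convergent:
  assumes meas: "\<And>n. a n \<in> borel_measurable M"
    and Cauchy: "\<And>e. e > 0 \<Longrightarrow> \<exists>N. \<forall>m\<ge>N. \<forall>n\<ge>N. (\<integral>\<^sup>+ x. ennreal ((a m x - a n x)\<^sup>2) \<partial>M) \<le> ennreal e"
  obtains r where "L2_asymptotic M a (\<lambda>_. r)"
proof -
  note [measurable] = meas
  obtain N where N: "(\<integral>\<^sup>+ x. ennreal ((a m x - a n x)\<^sup>2) \<partial>M) \<le> ennreal e"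
    if "e > 0" "m \<ge> N e" "n \<ge> N e" for e m n
    using Cauchy by metis
  \<comment> \<open>Summing the moduli makes \<open>s\<close> dominate all earlier ones without taking maxima.\<close>
  define s where "s j = (\<Sum>i\<le>j. N ((1/4)^i)) + j" for j
  have s_ge: "N ((1/4)^j) \<le> s j" "N ((1/4)^j) \<le> s (Suc j)" "j \<le> s j" for j
  proof -
    have le: "N ((1/4)^j) \<le> (\<Sum>i\<le>l. N ((1/4)^i))" if "j \<le> l" for l
      using that by (intro member_le_sum) auto
    show "N ((1/4)^j) \<le> s j" "N ((1/4)^j) \<le> s (Suc j)" "j \<le> s j"
      using le[of j] le[of "Suc j"] unfolding s_def by linarith+
  qed
  have step: "(\<integral>\<^sup>+ x. ennreal \<bar>a (s (Suc j)) x - a (s j) x\<bar> \<partial>M) \<le> ennreal ((1/2)^j)" for j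
  proof -
    let ?t = "\<lambda>x. a (s (Suc j)) x - a (s j) x"
    have "(\<integral>\<^sup>+ x. ennreal \<bar>?t x\<bar> \<partial>M)
        \<le> (\<integral>\<^sup>+ x. ennreal (2^j / 2) * ennreal ((?t x)\<^sup>2) + ennreal ((1/2)^j / 2) \<partial>M)"
    proof (rule nn_integral_mono)
      fix x
      \<comment> \<open>Weighting the square by \<open>2^j\<close> balances the two halves of the bound \<open>(1/2)^j\<close>.\<close>
      have "0 \<le> (2^j * \<bar>?t x\<bar> - 1)\<^sup>2" by simp
      then have "2 * 2^j * \<bar>?t x\<bar> \<le> (2^j)\<^sup>2 * (?t x)\<^sup>2 + 1"
        by (simp add: power2_diff power_mult_distrib)
      then have "\<bar>?t x\<bar> \<le> (2^j / 2) * (?t x)\<^sup>2 + (1/2)^j / 2"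
        by (simp add: field_simps power2_eq_square)
      then have "ennreal \<bar>?t x\<bar> \<le> ennreal ((2^j / 2) * (?t x)\<^sup>2 + (1/2)^j / 2)"
        by (rule ennreal_leI)
      then show "ennreal \<bar>?t x\<bar> \<le> ennreal (2^j / 2) * ennreal ((?t x)\<^sup>2) + ennreal ((1/2)^j / 2)"
        by (simp add: ennreal_plus[symmetric] ennreal_mult[symmetric] del: ennreal_plus)
    qed
    also have "\<dots> = ennreal (2^j / 2) * (\<integral>\<^sup>+ x. ennreal ((?t x)\<^sup>2) \<partial>M) + ennreal ((1/2)^j / 2)"
      by (simp add: nn_integral_add nn_integral_cmult emeasure_space_1)
    also have "\<dots> \<le> ennreal (2^j / 2) * ennreal ((1/4)^j) + ennreal ((1/2)^j / 2)"
      using N[of "(1/4)^j" "s (Suc j)" "s j"] s_ge[of j]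
      by (intro add_mono mult_left_mono) auto
    also have "\<dots> = ennreal ((1/2)^j)"
    proof -
      have "2^j * (1/4)^j = ((1/2)^j :: real)"
        by (simp add: power_mult_distrib[symmetric])
      then show ?thesis
        by (simp add: ennreal_plus[symmetric] ennreal_mult[symmetric] del: ennreal_plus)
    qed
    finally show ?thesis .
  qed
  have "(\<integral>\<^sup>+ x. (\<Sum>j. ennreal \<bar>a (s (Suc j)) x - a (s j) x\<bar>) \<partial>M)
      = (\<Sum>j. \<integral>\<^sup>+ x. ennreal \<bar>a (s (Suc j)) x - a (s j) x\<bar> \<partial>M)"
    by (rule nn_integral_suminf) auto
  also have "\<dots> \<le> (\<Sum>j. ennreal ((1/2)^j))"
    by (intro suminf_le step) auto
  also have "\<dots> = ennreal (\<Sum>j. (1/2)^j)"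
    by (intro suminf_ennreal2) auto
  finally have "(\<integral>\<^sup>+ x. (\<Sum>j. ennreal \<bar>a (s (Suc j)) x - a (s j) x\<bar>) \<partial>M) \<noteq> \<infinity>"
    by (auto simp: top_unique)
  then have "AE x in M. (\<Sum>j. ennreal \<bar>a (s (Suc j)) x - a (s j) x\<bar>) \<noteq> \<infinity>"
    by (intro nn_integral_PInf_AE) auto
  then have AE_conv: "AE x in M. (\<lambda>j. a (s j) x) \<longlonglongrightarrow> lim (\<lambda>j. a (s j) x)"
  proof eventually_elim
    fix x assume "(\<Sum>j. ennreal \<bar>a (s (Suc j)) x - a (s j) x\<bar>) \<noteq> \<infinity>"
    then have "summable (\<lambda>j. \<bar>a (s (Suc j)) x - a (s j) x\<bar>)"
      by (intro summable_suminf_not_top) auto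
    then have "summable (\<lambda>j. a (s (Suc j)) x - a (s j) x)"
      by (rule summable_rabs_cancel)
    then have "convergent (\<lambda>j. a (s 0) x + (\<Sum>i<j. a (s (Suc i)) x - a (s i) x))"
      unfolding summable_iff_convergent by (intro convergent_add convergent_const)
    then have "convergent (\<lambda>j. a (s j) x)"
      by (simp add: sum_lessThan_telescope[of "\<lambda>j. a (s j) x"] del: sum_subtractf)
    then show "(\<lambda>j. a (s j) x) \<longlonglongrightarrow> lim (\<lambda>j. a (s j) x)"
      by (simp add: convergent_LIMSEQ_iff)
  qed
  define r where "r x = lim (\<lambda>j. a (s j) x)" for x
  have [measurable]: "r \<in> borel_measurable M"
    unfolding r_def by measurable
  have bound: "(\<integral>\<^sup>+ x. ennreal ((a m x - r x)\<^sup>2) \<partial>M) \<le> ennreal e" if "e > 0" "m \<ge> N e" for e m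
  proof -
    have "(\<integral>\<^sup>+ x. ennreal ((a m x - r x)\<^sup>2) \<partial>M)
        = (\<integral>\<^sup>+ x. liminf (\<lambda>j. ennreal ((a m x - a (s j) x)\<^sup>2)) \<partial>M)"
    proof (rule nn_integral_cong_AE)
      show "AE x in M. ennreal ((a m x - r x)\<^sup>2) = liminf (\<lambda>j. ennreal ((a m x - a (s j) x)\<^sup>2))"
        using AE_conv
      proof eventually_elim
        fix x assume "(\<lambda>j. a (s j) x) \<longlonglongrightarrow> lim (\<lambda>j. a (s j) x)"
        then have "(\<lambda>j. ennreal ((a m x - a (s j) x)\<^sup>2)) \<longlonglongrightarrow> ennreal ((a m x - r x)\<^sup>2)"
          unfolding r_def by (intro tendsto_ennrealI tendsto_intros)
        then show "ennreal ((a m x - r x)\<^sup>2) = liminf (\<lambda>j. ennreal ((a m x - a (s j) x)\<^sup>2))"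
          by (intro lim_imp_Liminf[symmetric]) auto
      qed
    qed
    also have "\<dots> \<le> liminf (\<lambda>j. \<integral>\<^sup>+ x. ennreal ((a m x - a (s j) x)\<^sup>2) \<partial>M)"
      by (rule nn_integral_liminf) auto
    also have "\<dots> \<le> ennreal e"
    proof -
      have "\<forall>\<^sub>F j in sequentially. (\<integral>\<^sup>+ x. ennreal ((a m x - a (s j) x)\<^sup>2) \<partial>M) \<le> ennreal e"
        using eventually_ge_at_top[of "N e"]
      proof eventually_elim
        case (elim j)
        then show ?case
          using N[OF that, of "s j"] s_ge(3)[of j] by simp
      qed
      then have "liminf (\<lambda>j. \<integral>\<^sup>+ x. ennreal ((a m x - a (s j) x)\<^sup>2) \<partial>M) \<le> liminf (\<lambda>j. ennreal e)"
        by (rule Liminf_mono)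
      then show ?thesis
        by (simp add: Liminf_const)
    qed
    finally show ?thesis .
  qed
  have "(\<lambda>n. \<integral>\<^sup>+ x. ennreal ((a n x - r x)\<^sup>2) \<partial>M) \<longlonglongrightarrow> 0"
  proof (rule order_tendstoI)
    fix e :: ennreal assume "0 < e"
    then obtain d where d: "0 < d" "ennreal d < e"
      by (rule ennreal_real_between)
    show "\<forall>\<^sub>F n in sequentially. (\<integral>\<^sup>+ x. ennreal ((a n x - r x)\<^sup>2) \<partial>M) < e"
      using eventually_ge_at_top[of "N d"]
      by eventually_elim (use bound[OF d(1)] d(2) order_le_less_trans in blast)
  qed auto
  then have "L2_asymptotic M a (\<lambda>_. r)"
    by (auto simp: L2_asymptotic_def)
  then show ?thesis by (rule that)
qed

lemma (in prob_space) integrable_L2_limit: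
  assumes lim: "L2_asymptotic M a (\<lambda>_. r)" and int: "\<And>n. integrable M (a n)"
  shows "integrable M r"
proof -
  have [measurable]: "r \<in> borel_measurable M"
    using lim by (simp add: L2_asymptotic_def)
  have "\<forall>\<^sub>F n in sequentially. (\<integral>\<^sup>+ x. ennreal \<bar>a n x - r x\<bar> \<partial>M) < 1"
    using L2_asymptotic_imp_L1[OF lim] by (rule order_tendstoD(2)) simp
  then obtain n where n: "(\<integral>\<^sup>+ x. ennreal \<bar>a n x - r x\<bar> \<partial>M) < 1"
    by (auto simp: eventually_sequentially)
  then have "(\<integral>\<^sup>+ x. ennreal (norm (a n x - r x)) \<partial>M) < \<infinity>"
    using order_less_trans[OF n] by simp
  then have "integrable M (\<lambda>x. a n x - r x)"
    using int[of n] by (intro integrableI_bounded) auto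
  from Bochner_Integration.integrable_diff[OF int[of n] this] show ?thesis by simp
qed

section \<open>The Markov operator of a random walk by measure-preserving maps\<close>

text \<open>Only finitely many measure-preserving maps matter for the norm estimates; that they come from a
  group action enters when the limit is identified.\<close>

locale stationary_random_maps = prob_space M
  for M :: "'x measure" +
  fixes V :: "'v set" and P :: "'v \<Rightarrow> 'v \<Rightarrow> real" and \<nu> :: "'v \<Rightarrow> real"
    and \<tau> :: "'v \<Rightarrow> 'x \<Rightarrow> 'x"
  assumes finite_V: "finite V"
    and stochastic: "stochastic_matrix V P"
    and stationary: "stationary_distribution V P \<nu>"
    and \<nu>_pos: "\<And>v. v \<in> V \<Longrightarrow> \<nu> v > 0"
    and measurable_step [measurable]: "\<And>v. v \<in> V \<Longrightarrow> \<tau> v \<in> M \<rightarrow>\<^sub>M M"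
    and distr_step: "\<And>v. v \<in> V \<Longrightarrow> distr M M (\<tau> v) = M"
begin

lemma P_nonneg: "v \<in> V \<Longrightarrow> w \<in> V \<Longrightarrow> 0 \<le> P v w"
  and P_sum: "v \<in> V \<Longrightarrow> (\<Sum>w\<in>V. P v w) = 1"
  using stochastic by (auto simp: stochastic_matrix_def)

lemma \<nu>_sum: "(\<Sum>v\<in>V. \<nu> v) = 1"
  and \<nu>_stationary: "w \<in> V \<Longrightarrow> (\<Sum>v\<in>V. \<nu> v * P v w) = \<nu> w"
  using stationary by (auto simp: stationary_distribution_def)

text \<open>The transition operator of the chain that moves from \<open>(v, x)\<close> to \<open>(w, \<tau> w x)\<close> with probability
  \<open>P v w\<close>, acting on functions on \<open>V \<times> X\<close> in curried form.\<close>

definition markov :: "('v \<Rightarrow> 'x \<Rightarrow> real) \<Rightarrow> 'v \<Rightarrow> 'x \<Rightarrow> real" where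
  "markov \<psi> v x = (\<Sum>w\<in>V. P v w * \<psi> w (\<tau> w x))"

lemma markov_add: "markov (\<lambda>v x. \<psi> v x + \<phi> v x) = (\<lambda>v x. markov \<psi> v x + markov \<phi> v x)"
  by (simp add: markov_def algebra_simps sum.distrib fun_eq_iff)

lemma markov_diff: "markov (\<lambda>v x. \<psi> v x - \<phi> v x) = (\<lambda>v x. markov \<psi> v x - markov \<phi> v x)"
  by (simp add: markov_def algebra_simps sum_subtractf fun_eq_iff)

lemma markov_scaled_sum:
  "markov (\<lambda>v x. c * (\<Sum>i\<in>I. \<psi> i v x)) = (\<lambda>v x. c * (\<Sum>i\<in>I. markov (\<psi> i) v x))"
proof (intro ext)
  fix v x
  have "markov (\<lambda>v x. c * (\<Sum>i\<in>I. \<psi> i v x)) v x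
      = (\<Sum>w\<in>V. \<Sum>i\<in>I. c * (P v w * \<psi> i w (\<tau> w x)))"
    by (simp add: markov_def sum_distrib_left mult.left_commute)
  also have "\<dots> = (\<Sum>i\<in>I. \<Sum>w\<in>V. c * (P v w * \<psi> i w (\<tau> w x)))"
    by (rule sum.swap)
  also have "\<dots> = c * (\<Sum>i\<in>I. markov (\<psi> i) v x)"
    by (simp add: markov_def sum_distrib_left)
  finally show "markov (\<lambda>v x. c * (\<Sum>i\<in>I. \<psi> i v x)) v x = c * (\<Sum>i\<in>I. markov (\<psi> i) v x)" .
qed

lemma markov_pow_add:
  "(markov ^^ n) (\<lambda>v x. \<psi> v x + \<phi> v x) = (\<lambda>v x. (markov ^^ n) \<psi> v x + (markov ^^ n) \<phi> v x)"
  by (induction n) (simp_all add: markov_add)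

lemma markov_pow_diff:
  "(markov ^^ n) (\<lambda>v x. \<psi> v x - \<phi> v x) = (\<lambda>v x. (markov ^^ n) \<psi> v x - (markov ^^ n) \<phi> v x)"
  by (induction n) (simp_all add: markov_diff)

lemma markov_pow_scaled_sum:
  "(markov ^^ n) (\<lambda>v x. c * (\<Sum>i\<in>I. \<psi> i v x)) = (\<lambda>v x. c * (\<Sum>i\<in>I. (markov ^^ n) (\<psi> i) v x))"
  by (induction n) (simp_all add: markov_scaled_sum)

text \<open>Boundedness makes all squares and products below integrable. A bound for each vertex is enough
  because \<open>V\<close> is finite.\<close>

definition bounded_obs :: "('v \<Rightarrow> 'x \<Rightarrow> real) set" where
  "bounded_obs = {\<psi>. \<forall>v\<in>V. \<psi> v \<in> borel_measurable M \<and> (\<exists>C. \<forall>x\<in>space M. \<bar>\<psi> v x\<bar> \<le> C)}"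

lemma bounded_obs_measurable: "\<psi> \<in> bounded_obs \<Longrightarrow> v \<in> V \<Longrightarrow> \<psi> v \<in> borel_measurable M"
  by (simp add: bounded_obs_def)

lemma bounded_obs_sum:
  assumes "finite I" and "\<And>i. i \<in> I \<Longrightarrow> \<psi> i \<in> bounded_obs"
  shows "(\<lambda>v x. c * (\<Sum>i\<in>I. \<psi> i v x)) \<in> bounded_obs"
  unfolding bounded_obs_def
proof (intro CollectI ballI conjI)
  fix v assume v: "v \<in> V"
  have [measurable]: "\<psi> i v \<in> borel_measurable M" if "i \<in> I" for i
    using assms(2)[OF that] v by (rule bounded_obs_measurable)
  show "(\<lambda>x. c * (\<Sum>i\<in>I. \<psi> i v x)) \<in> borel_measurable M"
    by measurable
  have "\<exists>C. \<forall>x\<in>space M. \<bar>\<psi> i v x\<bar> \<le> C" if "i \<in> I" for i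
    using assms(2)[OF that] v by (auto simp: bounded_obs_def)
  then obtain C where C: "\<And>i x. i \<in> I \<Longrightarrow> x \<in> space M \<Longrightarrow> \<bar>\<psi> i v x\<bar> \<le> C i"
    by metis
  have "\<bar>c * (\<Sum>i\<in>I. \<psi> i v x)\<bar> \<le> \<bar>c\<bar> * (\<Sum>i\<in>I. C i)" if "x \<in> space M" for x
    unfolding abs_mult using C that
    by (intro mult_left_mono order_trans[OF sum_abs] sum_mono) auto
  then show "\<exists>C. \<forall>x\<in>space M. \<bar>c * (\<Sum>i\<in>I. \<psi> i v x)\<bar> \<le> C"
    by blast
qed

lemma bounded_obs_add:
  assumes "\<psi> \<in> bounded_obs" "\<phi> \<in> bounded_obs"
  shows "(\<lambda>v x. \<psi> v x + \<phi> v x) \<in> bounded_obs"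
  using bounded_obs_sum[of "UNIV :: bool set" "\<lambda>b. if b then \<psi> else \<phi>" 1] assms
  by (simp add: UNIV_bool add.commute)

lemma bounded_obs_diff:
  assumes "\<psi> \<in> bounded_obs" "\<phi> \<in> bounded_obs"
  shows "(\<lambda>v x. \<psi> v x - \<phi> v x) \<in> bounded_obs"
  using bounded_obs_add[OF assms(1) bounded_obs_sum[of "{()}" "\<lambda>_. \<phi>" "-1"]] assms by simp

lemma bounded_obs_markov:
  assumes "\<psi> \<in> bounded_obs"
  shows "markov \<psi> \<in> bounded_obs"
  unfolding bounded_obs_def
proof (intro CollectI ballI conjI)
  fix v assume v: "v \<in> V"
  have [measurable]: "\<psi> w \<in> borel_measurable M" if "w \<in> V" for w
    using assms that by (rule bounded_obs_measurable)
  show "markov \<psi> v \<in> borel_measurable M"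
    unfolding markov_def by measurable
  have "\<exists>C. \<forall>x\<in>space M. \<bar>\<psi> w x\<bar> \<le> C" if "w \<in> V" for w
    using assms that by (auto simp: bounded_obs_def)
  then obtain C where C: "\<And>w x. w \<in> V \<Longrightarrow> x \<in> space M \<Longrightarrow> \<bar>\<psi> w x\<bar> \<le> C w"
    by metis
  have "\<bar>markov \<psi> v x\<bar> \<le> (\<Sum>w\<in>V. P v w * C w)" if "x \<in> space M" for x
    unfolding markov_def using C that v measurable_space[OF measurable_step that]
    by (intro order_trans[OF sum_abs] sum_mono) (simp add: abs_mult P_nonneg mult_left_mono)
  then show "\<exists>C. \<forall>x\<in>space M. \<bar>markov \<psi> v x\<bar> \<le> C"
    by blast
qed

lemma bounded_obs_markov_pow: "\<psi> \<in> bounded_obs \<Longrightarrow> (markov ^^ n) \<psi> \<in> bounded_obs"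
  by (induction n) (simp_all add: bounded_obs_markov)

lemma bounded_obs_integrable_square:
  assumes "\<psi> \<in> bounded_obs" "v \<in> V"
  shows "integrable M (\<lambda>x. (\<psi> v x)\<^sup>2)"
proof -
  have [measurable]: "\<psi> v \<in> borel_measurable M"
    using assms by (rule bounded_obs_measurable)
  obtain C where "\<forall>x\<in>space M. \<bar>\<psi> v x\<bar> \<le> C"
    using assms by (auto simp: bounded_obs_def)
  then have "\<forall>x\<in>space M. norm ((\<psi> v x)\<^sup>2) \<le> C\<^sup>2"
    using power_mono[of "\<bar>\<psi> v _\<bar>" C 2] by auto
  then show ?thesis
    by (intro integrable_const_bound[of _ "C\<^sup>2"]) auto
qed

lemma integral_step:
  fixes g :: "'x \<Rightarrow> real"
  assumes "v \<in> V" "g \<in> borel_measurable M"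
  shows "(\<integral>x. g (\<tau> v x) \<partial>M) = (\<integral>x. g x \<partial>M)"
  using integral_distr[OF measurable_step[OF assms(1)] assms(2)] distr_step[OF assms(1)] by simp

lemma integrable_step:
  fixes g :: "'x \<Rightarrow> real"
  assumes "v \<in> V" "integrable M g"
  shows "integrable M (\<lambda>x. g (\<tau> v x))"
  using integrable_distr[of "\<tau> v" M M g] assms distr_step[OF assms(1)] measurable_step[OF assms(1)]
  by simp

lemma integrable_square_transition:
  assumes \<psi>: "\<psi> \<in> bounded_obs" and \<phi>: "\<phi> \<in> bounded_obs" and v: "v \<in> V" and w: "w \<in> V"
  shows "integrable M (\<lambda>x. (\<psi> w (\<tau> w x) - \<phi> v x)\<^sup>2)"
proof -
  have [measurable]: "\<psi> w \<in> borel_measurable M" "\<phi> v \<in> borel_measurable M" "\<tau> w \<in> M \<rightarrow>\<^sub>M M"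
    using bounded_obs_measurable[OF \<psi> w] bounded_obs_measurable[OF \<phi> v] w by auto
  obtain C where C: "\<forall>x\<in>space M. \<bar>\<psi> w x\<bar> \<le> C"
    using \<psi> w by (auto simp: bounded_obs_def)
  obtain D where D: "\<forall>x\<in>space M. \<bar>\<phi> v x\<bar> \<le> D"
    using \<phi> v by (auto simp: bounded_obs_def)
  have "norm ((\<psi> w (\<tau> w x) - \<phi> v x)\<^sup>2) \<le> (C + D)\<^sup>2" if x: "x \<in> space M" for x
  proof -
    have "\<bar>\<psi> w (\<tau> w x) - \<phi> v x\<bar> \<le> C + D"
      using C D x measurable_space[OF measurable_step[OF w] x]
      by (intro order_trans[OF abs_triangle_ineq4] add_mono) auto
    then have "\<bar>\<psi> w (\<tau> w x) - \<phi> v x\<bar>\<^sup>2 \<le> (C + D)\<^sup>2"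
      by (intro power_mono) auto
    then show ?thesis by simp
  qed
  then show ?thesis
    by (intro integrable_const_bound[of _ "(C + D)\<^sup>2"]) auto
qed

lemma sum_stationary:
  fixes c :: "'v \<Rightarrow> real"
  shows "(\<Sum>v\<in>V. \<nu> v * (\<Sum>w\<in>V. P v w * c w)) = (\<Sum>w\<in>V. \<nu> w * c w)"
proof -
  have "(\<Sum>v\<in>V. \<nu> v * (\<Sum>w\<in>V. P v w * c w)) = (\<Sum>v\<in>V. \<Sum>w\<in>V. (\<nu> v * P v w) * c w)"
    by (simp add: sum_distrib_left mult.assoc)
  also have "\<dots> = (\<Sum>w\<in>V. (\<Sum>v\<in>V. \<nu> v * P v w) * c w)"
    by (subst sum.swap) (simp add: sum_distrib_right)
  finally show ?thesis
    by (simp add: \<nu>_stationary)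
qed

text \<open>The squared norm of \<open>L\<^sup>2\<close> of the product of \<open>\<nu>\<close> and \<open>M\<close>.\<close>

definition norm_sq :: "('v \<Rightarrow> 'x \<Rightarrow> real) \<Rightarrow> real" where
  "norm_sq \<psi> = (\<Sum>v\<in>V. \<nu> v * (\<integral>x. (\<psi> v x)\<^sup>2 \<partial>M))"

lemma norm_sq_nonneg: "0 \<le> norm_sq \<psi>"
  unfolding norm_sq_def by (intro sum_nonneg mult_nonneg_nonneg) (auto intro: less_imp_le \<nu>_pos)

text \<open>The loss of norm is a variance. For fixed \<open>v\<close> and \<open>x\<close>, the number \<open>markov \<psi> v x\<close> is the mean of
  \<open>\<psi> w (\<tau> w x)\<close> under \<open>w \<sim> P v\<close>, so the mean squared deviation is the mean of the squares minus the
  square of the mean; stationarity of \<open>\<nu>\<close> turns the means of squares into \<open>norm_sq \<psi>\<close>.\<close>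

lemma norm_sq_markov:
  assumes \<psi>: "\<psi> \<in> bounded_obs"
  shows "norm_sq \<psi> - norm_sq (markov \<psi>)
    = (\<Sum>v\<in>V. \<nu> v * (\<Sum>w\<in>V. P v w * (\<integral>x. (\<psi> w (\<tau> w x) - markov \<psi> v x)\<^sup>2 \<partial>M)))"
proof -
  note int = integrable_square_transition[OF \<psi> bounded_obs_markov[OF \<psi>]]
  have var: "(\<Sum>w\<in>V. P v w * (\<integral>x. (\<psi> w (\<tau> w x) - markov \<psi> v x)\<^sup>2 \<partial>M))
      = (\<Sum>w\<in>V. P v w * (\<integral>x. (\<psi> w x)\<^sup>2 \<partial>M)) - (\<integral>x. (markov \<psi> v x)\<^sup>2 \<partial>M)" if v: "v \<in> V" for v
  proof -
    have pointwise: "(\<Sum>w\<in>V. P v w * (\<psi> w (\<tau> w x) - markov \<psi> v x)\<^sup>2)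
        = (\<Sum>w\<in>V. P v w * (\<psi> w (\<tau> w x))\<^sup>2) - (markov \<psi> v x)\<^sup>2" for x
    proof -
      define m where "m = markov \<psi> v x"
      have m: "(\<Sum>w\<in>V. P v w * \<psi> w (\<tau> w x)) = m"
        by (simp add: m_def markov_def)
      have "(\<Sum>w\<in>V. P v w * (\<psi> w (\<tau> w x) - m)\<^sup>2)
          = (\<Sum>w\<in>V. P v w * (\<psi> w (\<tau> w x))\<^sup>2 - 2 * m * (P v w * \<psi> w (\<tau> w x)) + m\<^sup>2 * P v w)"
        by (intro sum.cong refl) (simp add: power2_eq_square algebra_simps)
      also have "\<dots> = (\<Sum>w\<in>V. P v w * (\<psi> w (\<tau> w x))\<^sup>2) - 2 * m * m + m\<^sup>2"
        by (simp add: sum.distrib sum_subtractf sum_distrib_left[symmetric] m P_sum[OF v])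
      finally show ?thesis
        by (simp add: m_def power2_eq_square)
    qed
    have int': "integrable M (\<lambda>x. (\<psi> w (\<tau> w x))\<^sup>2)" if "w \<in> V" for w
      using integrable_step[OF that bounded_obs_integrable_square[OF \<psi> that]] .
    have "(\<Sum>w\<in>V. P v w * (\<integral>x. (\<psi> w (\<tau> w x) - markov \<psi> v x)\<^sup>2 \<partial>M))
        = (\<integral>x. (\<Sum>w\<in>V. P v w * (\<psi> w (\<tau> w x) - markov \<psi> v x)\<^sup>2) \<partial>M)"
      using int v by (subst Bochner_Integration.integral_sum) auto
    also have "\<dots> = (\<integral>x. (\<Sum>w\<in>V. P v w * (\<psi> w (\<tau> w x))\<^sup>2) \<partial>M) - (\<integral>x. (markov \<psi> v x)\<^sup>2 \<partial>M)"
      unfolding pointwise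
      using int' bounded_obs_integrable_square[OF bounded_obs_markov[OF \<psi>] v]
      by (intro Bochner_Integration.integral_diff) auto
    also have "(\<integral>x. (\<Sum>w\<in>V. P v w * (\<psi> w (\<tau> w x))\<^sup>2) \<partial>M) = (\<Sum>w\<in>V. P v w * (\<integral>x. (\<psi> w x)\<^sup>2 \<partial>M))"
    proof -
      have "(\<integral>x. (\<psi> w (\<tau> w x))\<^sup>2 \<partial>M) = (\<integral>x. (\<psi> w x)\<^sup>2 \<partial>M)" if "w \<in> V" for w
        using bounded_obs_measurable[OF \<psi> that]
        by (intro integral_step[OF that, where g = "\<lambda>x. (\<psi> w x)\<^sup>2"]) simp
      then show ?thesis
        using int' by (subst Bochner_Integration.integral_sum) auto
    qed
    finally show ?thesis .
  qed
  show ?thesis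
    using var by (simp add: right_diff_distrib sum_subtractf sum_stationary norm_sq_def)
qed

lemma norm_sq_markov_le:
  assumes "\<psi> \<in> bounded_obs"
  shows "norm_sq (markov \<psi>) \<le> norm_sq \<psi>"
proof -
  have "0 \<le> norm_sq \<psi> - norm_sq (markov \<psi>)"
    unfolding norm_sq_markov[OF assms]
    by (intro sum_nonneg mult_nonneg_nonneg P_nonneg integral_nonneg) (auto intro: less_imp_le \<nu>_pos)
  then show ?thesis by simp
qed

lemma norm_sq_orbit_convergent:
  assumes "\<psi> \<in> bounded_obs"
  obtains d where "(\<lambda>n. norm_sq ((markov ^^ n) \<psi>)) \<longlonglongrightarrow> d" and "\<And>n. d \<le> norm_sq ((markov ^^ n) \<psi>)"
proof -
  have "decseq (\<lambda>n. norm_sq ((markov ^^ n) \<psi>))"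
    using norm_sq_markov_le bounded_obs_markov_pow[OF assms] by (auto simp: decseq_Suc_iff)
  from decseq_convergent[OF this, of 0] norm_sq_nonneg that show ?thesis
    by metis
qed

lemma norm_sq_parallelogram:
  assumes "\<psi> \<in> bounded_obs" "\<phi> \<in> bounded_obs"
  shows "norm_sq (\<lambda>v x. \<psi> v x + \<phi> v x) + norm_sq (\<lambda>v x. \<psi> v x - \<phi> v x)
    = 2 * norm_sq \<psi> + 2 * norm_sq \<phi>"
proof -
  have *: "(\<integral>x. (\<psi> v x + \<phi> v x)\<^sup>2 \<partial>M) + (\<integral>x. (\<psi> v x - \<phi> v x)\<^sup>2 \<partial>M)
      = 2 * (\<integral>x. (\<psi> v x)\<^sup>2 \<partial>M) + 2 * (\<integral>x. (\<phi> v x)\<^sup>2 \<partial>M)" if v: "v \<in> V" for v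
  proof -
    note int = bounded_obs_integrable_square[OF bounded_obs_add[OF assms] v]
      bounded_obs_integrable_square[OF bounded_obs_diff[OF assms] v]
      bounded_obs_integrable_square[OF assms(1) v] bounded_obs_integrable_square[OF assms(2) v]
    have "(\<integral>x. (\<psi> v x + \<phi> v x)\<^sup>2 \<partial>M) + (\<integral>x. (\<psi> v x - \<phi> v x)\<^sup>2 \<partial>M)
        = (\<integral>x. (\<psi> v x + \<phi> v x)\<^sup>2 + (\<psi> v x - \<phi> v x)\<^sup>2 \<partial>M)"
      using int by simp
    also have "\<dots> = (\<integral>x. 2 * (\<psi> v x)\<^sup>2 + 2 * (\<phi> v x)\<^sup>2 \<partial>M)"
      by (rule Bochner_Integration.integral_cong) (auto simp: power2_eq_square algebra_simps)
    finally show ?thesis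
      using int by simp
  qed
  have "\<nu> v * (\<integral>x. (\<psi> v x + \<phi> v x)\<^sup>2 \<partial>M) + \<nu> v * (\<integral>x. (\<psi> v x - \<phi> v x)\<^sup>2 \<partial>M)
      = 2 * (\<nu> v * (\<integral>x. (\<psi> v x)\<^sup>2 \<partial>M)) + 2 * (\<nu> v * (\<integral>x. (\<phi> v x)\<^sup>2 \<partial>M))" if "v \<in> V" for v
  proof -
    have "\<nu> v * (A + B) = \<nu> v * (2 * C + 2 * D)" if "A + B = 2 * C + 2 * D" for A B C D :: real
      using that by simp
    from this[OF *[OF that]] show ?thesis
      by (simp add: distrib_left mult.left_commute)
  qed
  then show ?thesis
    unfolding norm_sq_def
    by (simp add: sum_distrib_left sum.distrib[symmetric])
qed

end

section \<open>Asymptotic determinism along paths\<close>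

text \<open>The end point \<open>v\<close> is kept apart from \<open>s\<close>, because \<open>\<tau> v\<close> is already accounted for in
  the state at \<open>v\<close>.\<close>

lemma directed_path_to:
  assumes "(u, v) \<in> (edges V P)\<^sup>*" "u \<in> V"
  obtains s where "directed_path V P (s @ [v])" "hd (s @ [v]) = u"
proof -
  from assms have "\<exists>s. directed_path V P (s @ [v]) \<and> hd (s @ [v]) = u"
  proof (induction rule: rtrancl_induct)
    case base
    then show ?case by (intro exI[of _ "[]"]) (auto simp: directed_path_def)
  next
    case (step w v)
    then obtain s where s: "directed_path V P (s @ [w])" "hd (s @ [w]) = u" by blast
    with step(2) have "directed_path V P ((s @ [w]) @ [v])" "hd ((s @ [w]) @ [v]) = u"
      by (auto simp: directed_path_def successively_append_iff edges_def hd_append)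
    then show ?case by blast
  qed
  then show ?thesis using that by blast
qed

context stationary_random_maps
begin

lemma measurable_foldr_step: "set s \<subseteq> V \<Longrightarrow> foldr \<tau> s \<in> M \<rightarrow>\<^sub>M M"
proof (induction s)
  case (Cons w s)
  then have "\<tau> w \<circ> foldr \<tau> s \<in> M \<rightarrow>\<^sub>M M"
    by (intro measurable_comp[of _ M M]) auto
  then show ?case by (simp add: comp_def)
qed (simp add: id_def)

lemma distr_foldr_step: "set s \<subseteq> V \<Longrightarrow> distr M M (foldr \<tau> s) = M"
proof (induction s)
  case (Cons w s)
  then have "distr M M (\<tau> w \<circ> foldr \<tau> s) = distr (distr M M (foldr \<tau> s)) M (\<tau> w)"
    by (intro distr_distr[symmetric] measurable_foldr_step) auto
  with Cons distr_step show ?case by (simp add: comp_def)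
qed (simp add: id_def distr_id)

text \<open>The losses of norm along an orbit are differences of a convergent sequence. Each of their
  summands is nonnegative, and the one belonging to an edge has a positive weight, so its integral
  tends to zero.\<close>

lemma L2_asymptotic_orbit_edge:
  assumes \<psi>: "\<psi> \<in> bounded_obs" and "(w, v) \<in> edges V P"
  shows "L2_asymptotic M (\<lambda>n. (markov ^^ Suc n) \<psi> v) (\<lambda>n x. (markov ^^ n) \<psi> w (\<tau> w x))"
proof -
  have v: "v \<in> V" and w: "w \<in> V" and pos: "P v w > 0"
    using assms(2) by (auto simp: edges_def)
  define a where "a n = (markov ^^ n) \<psi>" for n
  have a: "a n \<in> bounded_obs" and a_Suc: "a (Suc n) = markov (a n)" for n
    using bounded_obs_markov_pow[OF \<psi>] by (auto simp: a_def)
  have [measurable]: "a n u \<in> borel_measurable M" if "u \<in> V" for n u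
    using a that by (rule bounded_obs_measurable)
  note [measurable] = measurable_step[OF w]
  obtain d where "(\<lambda>n. norm_sq (a n)) \<longlonglongrightarrow> d"
    by (rule norm_sq_orbit_convergent[OF \<psi>]) (rule that, simp only: a_def)
  then have lim: "(\<lambda>n. (norm_sq (a n) - norm_sq (a (Suc n))) / (\<nu> v * P v w)) \<longlonglongrightarrow> (d - d) / (\<nu> v * P v w)"
    using \<nu>_pos[OF v] pos LIMSEQ_Suc[of "\<lambda>n. norm_sq (a n)" d]
    by (intro tendsto_divide tendsto_diff tendsto_const) auto
  let ?I = "\<lambda>n. \<integral>x. (a n w (\<tau> w x) - a (Suc n) v x)\<^sup>2 \<partial>M"
  have le: "?I n \<le> (norm_sq (a n) - norm_sq (a (Suc n))) / (\<nu> v * P v w)" for n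
  proof -
    let ?D = "\<lambda>v w. \<integral>x. (a n w (\<tau> w x) - markov (a n) v x)\<^sup>2 \<partial>M"
    have "\<nu> v * (P v w * ?D v w) \<le> \<nu> v * (\<Sum>w\<in>V. P v w * ?D v w)"
      using finite_V v w
      by (intro mult_left_mono member_le_sum mult_nonneg_nonneg P_nonneg) (auto intro: less_imp_le \<nu>_pos)
    also have "\<dots> \<le> (\<Sum>v\<in>V. \<nu> v * (\<Sum>w\<in>V. P v w * ?D v w))"
      using finite_V v
      by (intro member_le_sum mult_nonneg_nonneg P_nonneg sum_nonneg) (auto intro: less_imp_le \<nu>_pos)
    also have "\<dots> = norm_sq (a n) - norm_sq (a (Suc n))"
      using norm_sq_markov[OF a] by (simp add: a_Suc)
    finally show ?thesis
      using \<nu>_pos[OF v] pos by (simp add: a_Suc pos_le_divide_eq mult_ac)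
  qed
  have "?I \<longlonglongrightarrow> 0"
    using le lim by (intro tendsto_sandwich[where f = "\<lambda>_. 0" and g = ?I]) auto
  moreover have "(\<integral>\<^sup>+x. ennreal ((a (Suc n) v x - a n w (\<tau> w x))\<^sup>2) \<partial>M) = ennreal (?I n)" for n
    using integrable_square_transition[OF a a v w, of n "Suc n"]
    by (subst power2_commute, intro nn_integral_eq_integral) auto
  ultimately have "(\<lambda>n. \<integral>\<^sup>+x. ennreal ((a (Suc n) v x - a n w (\<tau> w x))\<^sup>2) \<partial>M) \<longlonglongrightarrow> 0"
    by (simp add: tendsto_ennrealI ennreal_0[symmetric] del: ennreal_0)
  then have "L2_asymptotic M (\<lambda>n. a (Suc n) v) (\<lambda>n x. a n w (\<tau> w x))"
    using v w by (simp add: L2_asymptotic_def)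
  then show ?thesis by (simp only: a_def)
qed

text \<open>Edges are chained from the end of the path to its start: passing to the preceding vertex costs
  one step of the orbit and one more map.\<close>

lemma L2_asymptotic_orbit_path:
  assumes \<psi>: "\<psi> \<in> bounded_obs" and "directed_path V P (s @ [v])"
  shows "L2_asymptotic M (\<lambda>n. (markov ^^ (n + length s)) \<psi> v)
           (\<lambda>n x. (markov ^^ n) \<psi> (hd (s @ [v])) (foldr \<tau> s x))"
  using assms(2)
proof (induction s)
  case Nil
  then show ?case
    using bounded_obs_measurable[OF bounded_obs_markov_pow[OF \<psi>]]
    by (auto simp: directed_path_def intro!: L2_asymptotic_refl)
next
  case (Cons w s)
  define w' where "w' = hd (s @ [v])"
  have path: "directed_path V P (s @ [v])" and edge: "(w, w') \<in> edges V P" and sub: "set s \<subseteq> V"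
    using Cons.prems by (auto simp: directed_path_def w'_def successively_Cons)
  have "L2_asymptotic M (\<lambda>n. (markov ^^ (n + 1 + length s)) \<psi> v)
          (\<lambda>n x. (markov ^^ (n + 1)) \<psi> w' (foldr \<tau> s x))"
    using L2_asymptotic_shift[OF Cons.IH[OF path], of 1] by (simp add: w'_def)
  moreover have "L2_asymptotic M (\<lambda>n x. (markov ^^ (n + 1)) \<psi> w' (foldr \<tau> s x))
      (\<lambda>n x. (markov ^^ n) \<psi> w (\<tau> w (foldr \<tau> s x)))"
    using L2_asymptotic_compose[OF L2_asymptotic_orbit_edge[OF \<psi> edge]
        measurable_foldr_step[OF sub] distr_foldr_step[OF sub]] by simp
  ultimately show ?case
    by (auto dest: L2_asymptotic_trans)
qed

text \<open>The paths \<open>upw\<close> and \<open>uqw\<close> make the orbit values at the first vertices of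
  \<open>p\<close> and \<open>q\<close> asymptotically equal, once directly and once after applying the maps of \<open>p\<close> and \<open>q\<close>.
  The path \<open>p q' p\<close> returns to the first vertex of \<open>p\<close> in \<open>2 * k\<close> steps, and the map of \<open>q'\<close> undoes that
  of \<open>q\<close>, so that after the exchange of \<open>p\<close> for \<open>q\<close> no map remains.\<close>

lemma L2_asymptotic_orbit_period:
  assumes \<psi>: "\<psi> \<in> bounded_obs"
    and "strongly_connected_graph V P"
    and upw: "directed_path V P ([u] @ p @ [w])" and uqw: "directed_path V P ([u] @ q @ [w])"
    and pqp: "directed_path V P (p @ q' @ p)"
    and len: "length p = k" "length q = k" "length q' = k" "k \<ge> 1"
    and inv: "\<And>x. x \<in> space M \<Longrightarrow> foldr \<tau> q (foldr \<tau> q' x) = x"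
    and v: "v \<in> V"
  shows "L2_asymptotic M (\<lambda>n. (markov ^^ (n + 2 * k)) \<psi> v) (\<lambda>n. (markov ^^ n) \<psi> v)"
proof -
  define a where "a n = (markov ^^ n) \<psi>" for n
  have meas: "a n z \<in> borel_measurable M" if "z \<in> V" for n z
    unfolding a_def using bounded_obs_markov_pow[OF \<psi>] that by (rule bounded_obs_measurable)
  have ne: "p \<noteq> []" "q \<noteq> []" using len by auto
  have sub: "set p \<subseteq> V" "set q \<subseteq> V" "set q' \<subseteq> V" "u \<in> V" "w \<in> V"
    using upw uqw pqp by (auto simp: directed_path_def)
  then have hd_V: "hd p \<in> V" "hd q \<in> V" using ne by (auto dest: hd_in_set)
  \<comment> \<open>Both first vertices are successors of \<open>u\<close>, so both orbit values follow the one at \<open>u\<close>.\<close>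
  have "(u, hd p) \<in> edges V P" "(u, hd q) \<in> edges V P"
    using upw uqw ne by (auto simp: directed_path_def successively_Cons)
  note this[THEN L2_asymptotic_orbit_edge[OF \<psi>]]
  from L2_asymptotic_trans[OF this(1) L2_asymptotic_sym[OF this(2)]]
  have "L2_asymptotic M (\<lambda>n. a (n + 1) (hd p)) (\<lambda>n. a (n + 1) (hd q))"
    by (simp add: a_def)
  then have hd_eq: "L2_asymptotic M (\<lambda>n. a n (hd p)) (\<lambda>n. a n (hd q))"
    by (rule L2_asymptotic_unshift) (use meas hd_V in auto)
  \<comment> \<open>Both paths end at \<open>w\<close>, so the orbit value at \<open>w\<close> can be computed along either.\<close>
  have "directed_path V P (p @ [w])" "directed_path V P (q @ [w])"
    using upw uqw by (auto simp: directed_path_def successively_Cons)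
  note this[THEN L2_asymptotic_orbit_path[OF \<psi>], unfolded len]
  from L2_asymptotic_trans[OF L2_asymptotic_sym[OF this(1)] this(2)]
  have "L2_asymptotic M (\<lambda>n x. a n (hd p) (foldr \<tau> p x)) (\<lambda>n x. a n (hd q) (foldr \<tau> q x))"
    using ne by (simp add: a_def)
  then have "L2_asymptotic M (\<lambda>n x. a n (hd p) (foldr \<tau> p (foldr \<tau> q' x)))
      (\<lambda>n x. a n (hd q) (foldr \<tau> q (foldr \<tau> q' x)))"
    by (rule L2_asymptotic_compose) (simp_all add: measurable_foldr_step distr_foldr_step sub)
  then have pq': "L2_asymptotic M (\<lambda>n x. a n (hd p) (foldr \<tau> p (foldr \<tau> q' x))) (\<lambda>n. a n (hd q))"
    by (rule L2_asymptotic_cong) (simp_all add: inv)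
  have "directed_path V P (((p @ q') @ [hd p]) @ tl p)"
    using pqp ne by simp
  then have "directed_path V P ((p @ q') @ [hd p])"
    unfolding directed_path_def successively_append_iff[of _ "(p @ q') @ [hd p]"] by auto
  from L2_asymptotic_orbit_path[OF \<psi> this]
  have "L2_asymptotic M (\<lambda>n. a (n + 2 * k) (hd p)) (\<lambda>n x. a n (hd p) (foldr \<tau> p (foldr \<tau> q' x)))"
    using ne len by (simp add: a_def mult_2)
  then have period: "L2_asymptotic M (\<lambda>n. a (n + 2 * k) (hd p)) (\<lambda>n. a n (hd p))"
    using L2_asymptotic_trans[OF _ L2_asymptotic_trans[OF pq' L2_asymptotic_sym[OF hd_eq]]] by blast
  \<comment> \<open>A path from the first vertex of \<open>p\<close> to \<open>v\<close> transports the period to \<open>v\<close>.\<close>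
  obtain s where s: "directed_path V P (s @ [v])" "hd (s @ [v]) = hd p"
    using directed_path_to assms(2) hd_V(1) v unfolding strongly_connected_graph_def by metis
  then have s_V: "set s \<subseteq> V" by (auto simp: directed_path_def)
  have along: "L2_asymptotic M (\<lambda>n. a (n + length s) v) (\<lambda>n x. a n (hd p) (foldr \<tau> s x))"
    using L2_asymptotic_orbit_path[OF \<psi> s(1)] s(2) by (simp add: a_def)
  have "L2_asymptotic M (\<lambda>n. a (n + 2 * k + length s) v) (\<lambda>n x. a (n + 2 * k) (hd p) (foldr \<tau> s x))"
    using L2_asymptotic_shift[OF along, of "2 * k"] .
  moreover have "L2_asymptotic M (\<lambda>n x. a (n + 2 * k) (hd p) (foldr \<tau> s x)) (\<lambda>n x. a n (hd p) (foldr \<tau> s x))"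
    using L2_asymptotic_compose[OF period measurable_foldr_step[OF s_V] distr_foldr_step[OF s_V]] .
  ultimately have "L2_asymptotic M (\<lambda>n. a (n + 2 * k + length s) v) (\<lambda>n. a (n + length s) v)"
    using L2_asymptotic_trans[OF _ L2_asymptotic_trans[OF _ L2_asymptotic_sym[OF along]]] by blast
  then have "L2_asymptotic M (\<lambda>n. a (n + length s + 2 * k) v) (\<lambda>n. a (n + length s) v)"
    by (simp add: add_ac)
  from L2_asymptotic_unshift[where a = "\<lambda>n. a (n + 2 * k) v", OF this meas[OF v] meas[OF v]]
  have "L2_asymptotic M (\<lambda>n. a (n + 2 * k) v) (\<lambda>n. a n v)" .
  then show ?thesis by (simp add: a_def)
qed

section \<open>Convergence of asymptotically stationary orbits\<close>

text \<open>Along an orbit with vanishing increments, \<open>a\<^sub>N\<^sub>+\<^sub>m - a\<^sub>N\<^sub>+\<^sub>n\<close> tends to zero as \<open>N\<close> grows. By the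
  parallelogram law the sums \<open>a\<^sub>N\<^sub>+\<^sub>m + a\<^sub>N\<^sub>+\<^sub>n\<close> then have squared norms tending to \<open>4 * d\<close>. They form the
  orbit of \<open>a\<^sub>m + a\<^sub>n\<close>, along which norms decrease, so \<open>4 * d\<close> is a lower bound for the squared norm
  of \<open>a\<^sub>m + a\<^sub>n\<close>; the parallelogram law for \<open>a\<^sub>m\<close> and \<open>a\<^sub>n\<close> gives the claim.\<close>

lemma norm_sq_orbit_dist:
  assumes \<psi>: "\<psi> \<in> bounded_obs"
    and slow: "\<And>v. v \<in> V \<Longrightarrow> L2_asymptotic M (\<lambda>n. (markov ^^ Suc n) \<psi> v) (\<lambda>n. (markov ^^ n) \<psi> v)"
    and lim: "(\<lambda>n. norm_sq ((markov ^^ n) \<psi>)) \<longlonglongrightarrow> d"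
  shows "norm_sq (\<lambda>v x. (markov ^^ m) \<psi> v x - (markov ^^ n) \<psi> v x)
    \<le> 2 * (norm_sq ((markov ^^ m) \<psi>) - d) + 2 * (norm_sq ((markov ^^ n) \<psi>) - d)"
proof -
  define a where "a n = (markov ^^ n) \<psi>" for n
  have a: "a n \<in> bounded_obs" for n
    unfolding a_def by (rule bounded_obs_markov_pow[OF \<psi>])
  have a_pow: "(markov ^^ N) (a n) = a (N + n)" for N n
    by (simp add: a_def funpow_add)
  define c where "c = (\<lambda>v x. a m v x + a n v x)"
  have c: "c \<in> bounded_obs"
    unfolding c_def by (rule bounded_obs_add[OF a a])
  have lim': "(\<lambda>N. norm_sq (a (N + j))) \<longlonglongrightarrow> d" for j
    using lim unfolding a_def by (rule LIMSEQ_ignore_initial_segment)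
  have "(\<lambda>N. norm_sq (\<lambda>v x. a (N + m) v x - a (N + n) v x)) \<longlonglongrightarrow> (\<Sum>v\<in>V. \<nu> v * 0)"
    unfolding norm_sq_def
  proof (intro tendsto_sum tendsto_mult_left)
    fix v assume v: "v \<in> V"
    have "L2_asymptotic M (\<lambda>N. a (N + j) v) (\<lambda>N. a N v)" for j
      using L2_asymptotic_iterate[OF slow[OF v]] by (simp add: a_def)
    from L2_asymptotic_trans[OF this L2_asymptotic_sym[OF this]]
    have "L2_asymptotic M (\<lambda>N. a (N + m) v) (\<lambda>N. a (N + n) v)" .
    then have "(\<lambda>N. \<integral>\<^sup>+x. ennreal ((a (N + m) v x - a (N + n) v x)\<^sup>2) \<partial>M) \<longlonglongrightarrow> 0"
      by (simp add: L2_asymptotic_def)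
    moreover have "(\<integral>\<^sup>+x. ennreal ((a (N + m) v x - a (N + n) v x)\<^sup>2) \<partial>M)
        = ennreal (\<integral>x. (a (N + m) v x - a (N + n) v x)\<^sup>2 \<partial>M)" for N
      using bounded_obs_integrable_square[OF bounded_obs_diff[OF a a] v]
      by (intro nn_integral_eq_integral) auto
    ultimately have "(\<lambda>N. ennreal (\<integral>x. (a (N + m) v x - a (N + n) v x)\<^sup>2 \<partial>M)) \<longlonglongrightarrow> ennreal 0"
      by simp
    then show "(\<lambda>N. \<integral>x. (a (N + m) v x - a (N + n) v x)\<^sup>2 \<partial>M) \<longlonglongrightarrow> 0"
      by (rule tendsto_ennrealD) auto
  qed
  then have "(\<lambda>N. 2 * norm_sq (a (N + m)) + 2 * norm_sq (a (N + n))
      - norm_sq (\<lambda>v x. a (N + m) v x - a (N + n) v x)) \<longlonglongrightarrow> 2 * d + 2 * d - 0"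
    by (intro tendsto_diff tendsto_add tendsto_mult_left lim') simp
  moreover have "norm_sq ((markov ^^ N) c) = 2 * norm_sq (a (N + m)) + 2 * norm_sq (a (N + n))
      - norm_sq (\<lambda>v x. a (N + m) v x - a (N + n) v x)" for N
    using norm_sq_parallelogram[OF a a, of "N + m" "N + n"]
    by (simp add: c_def markov_pow_add a_pow)
  ultimately have "(\<lambda>N. norm_sq ((markov ^^ N) c)) \<longlonglongrightarrow> 4 * d"
    by simp
  moreover obtain d' where "(\<lambda>N. norm_sq ((markov ^^ N) c)) \<longlonglongrightarrow> d'" "\<And>N. d' \<le> norm_sq ((markov ^^ N) c)"
    using norm_sq_orbit_convergent[OF c] by blast
  ultimately have "4 * d \<le> norm_sq c"
    using LIMSEQ_unique by (metis funpow_0)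
  then show ?thesis
    using norm_sq_parallelogram[OF a a, of m n] by (simp add: c_def a_def)
qed

lemma L2_convergent_orbit:
  assumes \<psi>: "\<psi> \<in> bounded_obs"
    and slow: "\<And>v. v \<in> V \<Longrightarrow> L2_asymptotic M (\<lambda>n. (markov ^^ Suc n) \<psi> v) (\<lambda>n. (markov ^^ n) \<psi> v)"
    and v: "v \<in> V"
  obtains r where "L2_asymptotic M (\<lambda>n. (markov ^^ n) \<psi> v) (\<lambda>_. r)"
proof -
  define a where "a n = (markov ^^ n) \<psi>" for n
  have a: "a n \<in> bounded_obs" for n
    unfolding a_def by (rule bounded_obs_markov_pow[OF \<psi>])
  obtain d where lim: "(\<lambda>n. norm_sq (a n)) \<longlonglongrightarrow> d"
    by (rule norm_sq_orbit_convergent[OF \<psi>]) (rule that, simp only: a_def)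
  have "\<exists>N. \<forall>m\<ge>N. \<forall>n\<ge>N. (\<integral>\<^sup>+ x. ennreal ((a m v x - a n v x)\<^sup>2) \<partial>M) \<le> ennreal e" if "e > 0" for e
  proof -
    have "\<forall>\<^sub>F n in sequentially. norm_sq (a n) < d + \<nu> v * e / 4"
      using lim by (rule order_tendstoD(2)) (use \<nu>_pos[OF v] that in simp)
    then obtain N where N: "\<And>n. n \<ge> N \<Longrightarrow> norm_sq (a n) < d + \<nu> v * e / 4"
      by (auto simp: eventually_sequentially)
    have "(\<integral>\<^sup>+ x. ennreal ((a m v x - a n v x)\<^sup>2) \<partial>M) \<le> ennreal e" if "m \<ge> N" "n \<ge> N" for m n
    proof -
      have "\<nu> v * (\<integral>x. (a m v x - a n v x)\<^sup>2 \<partial>M) \<le> norm_sq (\<lambda>v x. a m v x - a n v x)"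
        unfolding norm_sq_def using finite_V v
        by (intro member_le_sum mult_nonneg_nonneg) (auto intro: less_imp_le \<nu>_pos)
      also have "\<dots> \<le> 2 * (norm_sq (a m) - d) + 2 * (norm_sq (a n) - d)"
        using norm_sq_orbit_dist[OF \<psi> slow lim[unfolded a_def]] by (simp add: a_def)
      also have "\<dots> \<le> \<nu> v * e"
        using N[OF that(1)] N[OF that(2)] by simp
      finally have "(\<integral>x. (a m v x - a n v x)\<^sup>2 \<partial>M) \<le> e"
        using \<nu>_pos[OF v] by simp
      moreover have "(\<integral>\<^sup>+ x. ennreal ((a m v x - a n v x)\<^sup>2) \<partial>M) = ennreal (\<integral>x. (a m v x - a n v x)\<^sup>2 \<partial>M)"
        using bounded_obs_integrable_square[OF bounded_obs_diff[OF a a] v]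
        by (intro nn_integral_eq_integral) auto
      ultimately show ?thesis
        by (simp add: ennreal_leI)
    qed
    then show ?thesis by blast
  qed
  then obtain r where "L2_asymptotic M (\<lambda>n. a n v) (\<lambda>_. r)"
    using L2_Cauchy_convergent[of "\<lambda>n. a n v"] bounded_obs_measurable[OF a v] by blast
  then show ?thesis
    using that by (simp add: a_def)
qed

end

section \<open>Measure-preserving actions\<close>

context
  fixes F :: "('g, 'm) monoid_scheme" and M :: "'x measure" and T :: "'g \<Rightarrow> 'x \<Rightarrow> 'x"
  assumes group: "group F" and action: "pmp_action F M T"
begin

lemma pmp_action_measurable: "g \<in> carrier F \<Longrightarrow> T g \<in> M \<rightarrow>\<^sub>M M"
  and pmp_action_distr: "g \<in> carrier F \<Longrightarrow> distr M M (T g) = M"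
  and pmp_action_Bij: "g \<in> carrier F \<Longrightarrow> T g \<in> Bij (space M)"
  using action by (auto simp: pmp_action_def hom_def measure_aut_group_def)

lemma pmp_action_mult:
  assumes "g \<in> carrier F" "h \<in> carrier F" "x \<in> space M"
  shows "T (g \<otimes>\<^bsub>F\<^esub> h) x = T g (T h x)"
proof -
  have "T (g \<otimes>\<^bsub>F\<^esub> h) = compose (space M) (T g) (T h)"
    using action assms pmp_action_Bij[OF assms(1)] pmp_action_Bij[OF assms(2)]
    by (simp add: pmp_action_def hom_def measure_aut_group_def BijGroup_def)
  then show ?thesis
    using assms(3) by (simp add: compose_def)
qed

lemma pmp_action_one:
  assumes x: "x \<in> space M"
  shows "T \<one>\<^bsub>F\<^esub> x = x"
proof -
  have one: "\<one>\<^bsub>F\<^esub> \<in> carrier F"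
    using group by (simp add: group.is_monoid monoid.one_closed)
  have "T \<one>\<^bsub>F\<^esub> (T \<one>\<^bsub>F\<^esub> x) = T \<one>\<^bsub>F\<^esub> x"
    using pmp_action_mult[OF one one x] group by (simp add: group.is_monoid)
  moreover have "inj_on (T \<one>\<^bsub>F\<^esub>) (space M)"
    using pmp_action_Bij[OF one] by (simp add: Bij_def bij_betw_def)
  ultimately show ?thesis
    using x measurable_space[OF pmp_action_measurable[OF one] x] by (auto dest: inj_onD)
qed

lemma pmp_action_inv:
  assumes "g \<in> carrier F" "x \<in> space M"
  shows "T (inv\<^bsub>F\<^esub> g) (T g x) = x" "T g (T (inv\<^bsub>F\<^esub> g) x) = x"
  using pmp_action_mult[of "inv\<^bsub>F\<^esub> g" g x] pmp_action_mult[of g "inv\<^bsub>F\<^esub> g" x] pmp_action_one[of x] assms group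
  by (simp_all add: group.inv_closed group.l_inv group.r_inv)

lemma measurable_invariant_algebra:
  fixes r :: "'x \<Rightarrow> real"
  assumes r: "r \<in> borel_measurable M"
    and inv: "\<And>g x. g \<in> carrier F \<Longrightarrow> x \<in> space M \<Longrightarrow> r (T g x) = r x"
  shows "r \<in> borel_measurable (invariant_algebra F M T)"
proof (rule measurableI)
  fix B :: "real set" assume "B \<in> sets borel"
  then have "r -` B \<inter> space M \<in> sets M"
    using r by (rule measurable_sets[rotated])
  moreover have "T g -` (r -` B \<inter> space M) \<inter> space M = r -` B \<inter> space M" if "g \<in> carrier F" for g
    using inv[OF that] measurable_space[OF pmp_action_measurable[OF that]] by auto
  ultimately show "r -` B \<inter> space (invariant_algebra F M T) \<in> sets (invariant_algebra F M T)"
    using subalgebra_invariant_algebra[OF action] sets_invariant_algebra[OF action]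
    by (simp add: subalgebra_def)
qed simp

text \<open>The points where \<open>r\<close> is constant on the orbit form an invariant set. It is measurable and of full
  measure because only countably many conditions define it, so \<open>r\<close> may be set to \<open>0\<close> off it.\<close>

lemma AE_invariant_strictly_invariant:
  fixes r :: "'x \<Rightarrow> real"
  assumes r: "r \<in> borel_measurable M" and countable: "countable (carrier F)"
    and inv: "\<And>g. g \<in> carrier F \<Longrightarrow> AE x in M. r (T g x) = r x"
  obtains r' where "r' \<in> borel_measurable (invariant_algebra F M T)" "AE x in M. r' x = r x"
proof -
  define X where "X = {x \<in> space M. \<forall>g\<in>carrier F. r (T g x) = r x}"
  note [measurable] = r pmp_action_measurable
  have X [measurable]: "X \<in> sets M"
    unfolding X_def using countable by measurable
  have AE_X: "AE x in M. x \<in> X"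
    using inv countable AE_space
    by (subst X_def) (simp add: AE_conj_iff AE_ball_countable)
  define r' where "r' x = (if x \<in> X then r x else 0)" for x
  have r': "r' \<in> borel_measurable M"
    unfolding r'_def by measurable
  have in_X: "T h x \<in> X" if x: "x \<in> X" and h: "h \<in> carrier F" for x h
  proof -
    have "r (T g (T h x)) = r (T h x)" if g: "g \<in> carrier F" for g
    proof -
      have "r (T g (T h x)) = r (T (g \<otimes>\<^bsub>F\<^esub> h) x)"
        using pmp_action_mult[OF g h] x by (simp add: X_def)
      then show ?thesis
        using x g h group by (simp add: X_def group.is_monoid monoid.m_closed)
    qed
    then show ?thesis
      using x measurable_space[OF pmp_action_measurable[OF h]] by (simp add: X_def)
  qed
  have "r' (T g x) = r' x" if g: "g \<in> carrier F" and x: "x \<in> space M" for g x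
  proof (cases "x \<in> X")
    case True
    with in_X[OF True g] g show ?thesis by (simp add: r'_def X_def)
  next
    case False
    then have "T g x \<notin> X"
      using in_X[of "T g x" "inv\<^bsub>F\<^esub> g"] pmp_action_inv(1)[OF g x] g group
      by (auto simp: group.inv_closed)
    with False show ?thesis by (simp add: r'_def)
  qed
  from measurable_invariant_algebra[OF r' this]
  have "r' \<in> borel_measurable (invariant_algebra F M T)" .
  moreover have "AE x in M. r' x = r x"
    using AE_X by eventually_elim (simp add: r'_def)
  ultimately show ?thesis by (rule that)
qed

end

lemma countable_carrier_if_finitely_generated:
  fixes F :: "('g, 'm) monoid_scheme"
  assumes "finitely_generated_group F"
  shows "countable (carrier F)"
proof -
  obtain S where S: "finite S" "S \<subseteq> carrier F" "generate F S = carrier F" and "group F"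
    using assms by (auto simp: finitely_generated_group_def)
  interpret group F by fact
  have val_closed: "word_val F ls \<in> carrier F" if "ls \<in> lists (S \<times> UNIV)" for ls
    using that S(2) by (induction ls) (auto simp: word_val_def letter_val_def)
  have val_append: "word_val F (ls @ ms) = word_val F ls \<otimes>\<^bsub>F\<^esub> word_val F ms"
    if "ls \<in> lists (S \<times> UNIV)" "ms \<in> lists (S \<times> UNIV)" for ls ms
    using that
  proof (induction ls)
    case (Cons l ls)
    then have "letter_val F l \<in> carrier F" using S(2) by (auto simp: letter_val_def)
    with Cons val_closed show ?case by (simp add: word_val_def m_assoc)
  qed (use val_closed in \<open>simp add: word_val_def\<close>)
  have "g \<in> word_val F ` lists (S \<times> UNIV)" if "g \<in> generate F S" for g
    using that
  proof induction
    case one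
    show ?case by (rule image_eqI[of _ _ "[]"]) (auto simp: word_val_def)
  next
    case (incl h)
    with S(2) show ?case
      by (intro image_eqI[of _ _ "[(h, True)]"]) (auto simp: word_val_def letter_val_def)
  next
    case (inv h)
    with S(2) show ?case
      by (intro image_eqI[of _ _ "[(h, False)]"]) (auto simp: word_val_def letter_val_def)
  next
    case (eng h1 h2)
    then obtain ls ms where "ls \<in> lists (S \<times> UNIV)" "ms \<in> lists (S \<times> UNIV)"
      "h1 = word_val F ls" "h2 = word_val F ms" by blast
    with val_append show ?case by (intro image_eqI[of _ _ "ls @ ms"]) auto
  qed
  then have "carrier F \<subseteq> word_val F ` lists (S \<times> UNIV)"
    using S(3) by auto
  moreover have "countable (word_val F ` lists (S \<times> (UNIV :: bool set)))"
    using S(1) by (intro countable_image countable_lists countable_SIGMA) (auto intro: countable_finite)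
  ultimately show ?thesis
    by (rule countable_subset)
qed

section \<open>Averages over orbits of the Markov operator\<close>

context stationary_random_maps
begin

lemma bounded_obs_const:
  assumes "f \<in> borel_measurable M" "\<And>x. x \<in> space M \<Longrightarrow> \<bar>f x\<bar> \<le> C"
  shows "(\<lambda>_. f) \<in> bounded_obs"
  using assms by (auto simp: bounded_obs_def)

lemma bounded_obs_integrable:
  assumes "\<psi> \<in> bounded_obs" "v \<in> V"
  shows "integrable M (\<psi> v)"
proof -
  obtain C where "\<forall>x\<in>space M. \<bar>\<psi> v x\<bar> \<le> C"
    using assms by (auto simp: bounded_obs_def)
  then show ?thesis
    using bounded_obs_measurable[OF assms] by (intro integrable_const_bound[of _ C]) auto
qed

definition window_average :: "nat \<Rightarrow> ('x \<Rightarrow> real) \<Rightarrow> 'v \<Rightarrow> 'x \<Rightarrow> real" where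
  "window_average N f v x = 1 / real N * (\<Sum>i<N. (markov ^^ i) (\<lambda>_. f) v x)"

lemma markov_pow_window_average:
  "(markov ^^ n) (window_average N f)
    = (\<lambda>v x. 1 / real N * (\<Sum>i<N. (markov ^^ (n + i)) (\<lambda>_. f) v x))"
proof -
  have "window_average N f = (\<lambda>v x. 1 / real N * (\<Sum>i\<in>{..<N}. (markov ^^ i) (\<lambda>_. f) v x))"
    by (intro ext) (simp add: window_average_def)
  then show ?thesis
    by (simp only: markov_pow_scaled_sum funpow_add comp_apply)
qed

lemma bounded_obs_window_average:
  assumes "(\<lambda>_. f) \<in> bounded_obs"
  shows "window_average N f \<in> bounded_obs"
  unfolding window_average_def[abs_def]
  by (intro bounded_obs_sum bounded_obs_markov_pow assms) simp

text \<open>Shifting a window by one replaces its first term by the term \<open>N\<close> steps later, so asymptotic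
  period \<open>N\<close> of the orbit makes the increments of the window averages vanish.\<close>

lemma L2_asymptotic_window_average:
  assumes f: "(\<lambda>_. f) \<in> bounded_obs" and v: "v \<in> V"
    and period: "L2_asymptotic M (\<lambda>n. (markov ^^ (n + N)) (\<lambda>_. f) v) (\<lambda>n. (markov ^^ n) (\<lambda>_. f) v)"
  shows "L2_asymptotic M (\<lambda>n. (markov ^^ Suc n) (window_average N f) v)
           (\<lambda>n. (markov ^^ n) (window_average N f) v)"
proof (rule L2_asymptotic_scaled[OF period, where c = "1 / real N"])
  fix n x
  define b where "b j = (markov ^^ j) (\<lambda>_. f) v x" for j
  have "(markov ^^ Suc n) (window_average N f) v x - (markov ^^ n) (window_average N f) v x
      = 1 / real N * (\<Sum>i<N. b (n + Suc i) - b (n + i))"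
    unfolding markov_pow_window_average b_def
    by (simp only: sum_subtractf right_diff_distrib add_Suc add_Suc_right)
  also have "\<dots> = 1 / real N * (b (n + N) - b (n + 0))"
    by (subst sum_lessThan_telescope[of "\<lambda>i. b (n + i)"]) simp
  finally show "(markov ^^ Suc n) (window_average N f) v x - (markov ^^ n) (window_average N f) v x
      = 1 / real N * ((markov ^^ (n + N)) (\<lambda>_. f) v x - (markov ^^ n) (\<lambda>_. f) v x)"
    by (simp add: b_def)
qed (rule bounded_obs_measurable[OF bounded_obs_markov_pow[OF bounded_obs_window_average[OF f]] v])+

text \<open>Multiplication by the indicator of a set that is invariant under all \<open>\<tau> w\<close> commutes with \<open>markov\<close>,
  which preserves means.\<close>

lemma set_mean_markov:
  assumes \<psi>: "\<psi> \<in> bounded_obs" and A: "A \<in> sets M"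
    and inv: "\<And>w. w \<in> V \<Longrightarrow> \<tau> w -` A \<inter> space M = A"
  shows "(\<Sum>v\<in>V. \<nu> v * (\<integral>x\<in>A. markov \<psi> v x \<partial>M)) = (\<Sum>v\<in>V. \<nu> v * (\<integral>x\<in>A. \<psi> v x \<partial>M))"
proof -
  have "(\<integral>x\<in>A. markov \<psi> v x \<partial>M) = (\<Sum>w\<in>V. P v w * (\<integral>x\<in>A. \<psi> w x \<partial>M))" for v
  proof -
    have int: "integrable M (\<lambda>x. indicator A x * \<psi> w x)" if "w \<in> V" for w
      using integrable_mult_indicator[OF A bounded_obs_integrable[OF \<psi> that]] by simp
    have ind: "indicator A (\<tau> w x) = (indicator A x :: real)" if "w \<in> V" "x \<in> space M" for w x
      using inv[OF that(1)] that(2) by (auto simp: indicator_def)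
    have "(\<integral>x\<in>A. markov \<psi> v x \<partial>M)
        = (\<integral>x. (\<Sum>w\<in>V. P v w * (indicator A (\<tau> w x) * \<psi> w (\<tau> w x))) \<partial>M)"
      unfolding set_lebesgue_integral_def markov_def
      by (intro Bochner_Integration.integral_cong refl)
        (auto simp: sum_distrib_left ind mult.left_commute intro!: sum.cong)
    also have "\<dots> = (\<Sum>w\<in>V. P v w * (\<integral>x. indicator A (\<tau> w x) * \<psi> w (\<tau> w x) \<partial>M))"
      using integrable_step[OF _ int] by (subst Bochner_Integration.integral_sum) auto
    also have "\<dots> = (\<Sum>w\<in>V. P v w * (\<integral>x\<in>A. \<psi> w x \<partial>M))"
    proof (intro sum.cong refl arg_cong2[of _ _ _ _ "(*)"])
      fix w assume w: "w \<in> V"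
      show "(\<integral>x. indicator A (\<tau> w x) * \<psi> w (\<tau> w x) \<partial>M) = (\<integral>x\<in>A. \<psi> w x \<partial>M)"
        using integral_step[OF w, of "\<lambda>x. indicator A x * \<psi> w x"] int[OF w]
        by (simp add: set_lebesgue_integral_def)
    qed
    finally show ?thesis .
  qed
  then show ?thesis
    by (simp add: sum_stationary)
qed

lemma set_mean_markov_pow:
  assumes \<psi>: "\<psi> \<in> bounded_obs" and A: "A \<in> sets M"
    and inv: "\<And>w. w \<in> V \<Longrightarrow> \<tau> w -` A \<inter> space M = A"
  shows "(\<Sum>v\<in>V. \<nu> v * (\<integral>x\<in>A. (markov ^^ n) \<psi> v x \<partial>M)) = (\<Sum>v\<in>V. \<nu> v * (\<integral>x\<in>A. \<psi> v x \<partial>M))"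
  by (induction n) (simp_all add: set_mean_markov[OF bounded_obs_markov_pow[OF \<psi>] A inv])

lemma set_mean_window_average:
  assumes f: "(\<lambda>_. f) \<in> bounded_obs" and A: "A \<in> sets M" and "N > 0"
    and inv: "\<And>w. w \<in> V \<Longrightarrow> \<tau> w -` A \<inter> space M = A"
  shows "(\<Sum>v\<in>V. \<nu> v * (\<integral>x\<in>A. (markov ^^ n) (window_average N f) v x \<partial>M)) = (\<integral>x\<in>A. f x \<partial>M)"
proof -
  have "(\<integral>x\<in>A. window_average N f v x \<partial>M)
      = 1 / real N * (\<Sum>i<N. \<integral>x\<in>A. (markov ^^ i) (\<lambda>_. f) v x \<partial>M)" if v: "v \<in> V" for v
  proof -
    have int: "integrable M (\<lambda>x. indicator A x * (markov ^^ i) (\<lambda>_. f) v x)" for i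
      using integrable_mult_indicator[OF A bounded_obs_integrable[OF bounded_obs_markov_pow[OF f] v]] by simp
    have "(\<integral>x\<in>A. window_average N f v x \<partial>M)
        = (\<integral>x. 1 / real N * (\<Sum>i<N. indicator A x * (markov ^^ i) (\<lambda>_. f) v x) \<partial>M)"
      unfolding set_lebesgue_integral_def window_average_def
      by (intro Bochner_Integration.integral_cong refl) (simp add: indicator_def)
    also have "\<dots> = 1 / real N * (\<Sum>i<N. \<integral>x. indicator A x * (markov ^^ i) (\<lambda>_. f) v x \<partial>M)"
      using int by (simp only: integral_mult_right_zero Bochner_Integration.integral_sum)
    finally show ?thesis
      by (simp add: set_lebesgue_integral_def)
  qed
  then have "(\<Sum>v\<in>V. \<nu> v * (\<integral>x\<in>A. window_average N f v x \<partial>M))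
      = (\<Sum>v\<in>V. \<Sum>i<N. 1 / real N * (\<nu> v * (\<integral>x\<in>A. (markov ^^ i) (\<lambda>_. f) v x \<partial>M)))"
    by (intro sum.cong refl) (simp add: sum_distrib_left mult.left_commute)
  also have "\<dots> = (\<Sum>i<N. 1 / real N * (\<Sum>v\<in>V. \<nu> v * (\<integral>x\<in>A. (markov ^^ i) (\<lambda>_. f) v x \<partial>M)))"
    by (subst sum.swap) (simp add: sum_distrib_left)
  also have "\<dots> = (\<Sum>i<N. 1 / real N * (\<integral>x\<in>A. f x \<partial>M))"
    by (simp only: set_mean_markov_pow[OF f A inv] sum_distrib_right[symmetric] \<nu>_sum mult_1_left)
  also have "\<dots> = (\<integral>x\<in>A. f x \<partial>M)"
    using \<open>N > 0\<close> by simp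
  finally show ?thesis
    using set_mean_markov_pow[OF bounded_obs_window_average[OF f] A inv] by simp
qed

lemma nn_integral_step:
  assumes "v \<in> V" "g \<in> borel_measurable M"
  shows "(\<integral>\<^sup>+x. g (\<tau> v x) \<partial>M) = (\<integral>\<^sup>+x. g x \<partial>M)"
  using nn_integral_distr[OF measurable_step[OF assms(1)] ] distr_step[OF assms(1)] assms by metis

definition norm1 :: "('v \<Rightarrow> 'x \<Rightarrow> real) \<Rightarrow> ennreal" where
  "norm1 \<psi> = (\<Sum>v\<in>V. ennreal (\<nu> v) * (\<integral>\<^sup>+x. ennreal \<bar>\<psi> v x\<bar> \<partial>M))"

lemma nn_integral_mean_le:
  assumes \<psi>: "\<And>v. v \<in> V \<Longrightarrow> \<psi> v \<in> borel_measurable M"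
  shows "(\<integral>\<^sup>+x. ennreal \<bar>\<Sum>v\<in>V. \<nu> v * \<psi> v x\<bar> \<partial>M) \<le> norm1 \<psi>"
proof -
  note [measurable] = \<psi>
  have "(\<integral>\<^sup>+x. ennreal \<bar>\<Sum>v\<in>V. \<nu> v * \<psi> v x\<bar> \<partial>M)
      \<le> (\<integral>\<^sup>+x. (\<Sum>v\<in>V. ennreal (\<nu> v) * ennreal \<bar>\<psi> v x\<bar>) \<partial>M)"
  proof (rule nn_integral_mono)
    fix x
    have "\<bar>\<Sum>v\<in>V. \<nu> v * \<psi> v x\<bar> \<le> (\<Sum>v\<in>V. \<nu> v * \<bar>\<psi> v x\<bar>)"
      using \<nu>_pos by (intro order_trans[OF sum_abs] sum_mono) (simp add: abs_mult less_imp_le)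
    then have "ennreal \<bar>\<Sum>v\<in>V. \<nu> v * \<psi> v x\<bar> \<le> ennreal (\<Sum>v\<in>V. \<nu> v * \<bar>\<psi> v x\<bar>)"
      by (rule ennreal_leI)
    also have "\<dots> = (\<Sum>v\<in>V. ennreal (\<nu> v) * ennreal \<bar>\<psi> v x\<bar>)"
      using \<nu>_pos by (subst sum_ennreal[symmetric]) (auto simp: less_imp_le ennreal_mult)
    finally show "ennreal \<bar>\<Sum>v\<in>V. \<nu> v * \<psi> v x\<bar> \<le> (\<Sum>v\<in>V. ennreal (\<nu> v) * ennreal \<bar>\<psi> v x\<bar>)" .
  qed
  also have "\<dots> = (\<Sum>v\<in>V. \<integral>\<^sup>+x. ennreal (\<nu> v) * ennreal \<bar>\<psi> v x\<bar> \<partial>M)"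
    by (rule nn_integral_sum) measurable
  also have "\<dots> = norm1 \<psi>"
    unfolding norm1_def by (intro sum.cong refl nn_integral_cmult) measurable
  finally show ?thesis .
qed

lemma norm1_markov_le:
  assumes \<psi>: "\<And>v. v \<in> V \<Longrightarrow> \<psi> v \<in> borel_measurable M"
  shows "norm1 (markov \<psi>) \<le> norm1 \<psi>"
proof -
  note [measurable] = \<psi>
  let ?J = "\<lambda>w. \<integral>\<^sup>+x. ennreal \<bar>\<psi> w x\<bar> \<partial>M"
  have "(\<integral>\<^sup>+x. ennreal \<bar>markov \<psi> v x\<bar> \<partial>M) \<le> (\<Sum>w\<in>V. ennreal (P v w) * ?J w)" if v: "v \<in> V" for v
  proof -
    have "(\<integral>\<^sup>+x. ennreal \<bar>markov \<psi> v x\<bar> \<partial>M)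
        \<le> (\<integral>\<^sup>+x. (\<Sum>w\<in>V. ennreal (P v w) * ennreal \<bar>\<psi> w (\<tau> w x)\<bar>) \<partial>M)"
    proof (rule nn_integral_mono)
      fix x
      have "\<bar>markov \<psi> v x\<bar> \<le> (\<Sum>w\<in>V. P v w * \<bar>\<psi> w (\<tau> w x)\<bar>)"
        unfolding markov_def using v
        by (intro order_trans[OF sum_abs] sum_mono) (simp add: abs_mult P_nonneg)
      then have "ennreal \<bar>markov \<psi> v x\<bar> \<le> ennreal (\<Sum>w\<in>V. P v w * \<bar>\<psi> w (\<tau> w x)\<bar>)"
        by (rule ennreal_leI)
      also have "\<dots> = (\<Sum>w\<in>V. ennreal (P v w) * ennreal \<bar>\<psi> w (\<tau> w x)\<bar>)"
        using v by (subst sum_ennreal[symmetric]) (auto simp: P_nonneg ennreal_mult)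
      finally show "ennreal \<bar>markov \<psi> v x\<bar> \<le> (\<Sum>w\<in>V. ennreal (P v w) * ennreal \<bar>\<psi> w (\<tau> w x)\<bar>)" .
    qed
    also have "\<dots> = (\<Sum>w\<in>V. \<integral>\<^sup>+x. ennreal (P v w) * ennreal \<bar>\<psi> w (\<tau> w x)\<bar> \<partial>M)"
      by (rule nn_integral_sum) measurable
    also have "\<dots> = (\<Sum>w\<in>V. ennreal (P v w) * ?J w)"
    proof (rule sum.cong[OF refl])
      fix w assume w: "w \<in> V"
      have "(\<integral>\<^sup>+x. ennreal (P v w) * ennreal \<bar>\<psi> w (\<tau> w x)\<bar> \<partial>M)
          = ennreal (P v w) * (\<integral>\<^sup>+x. ennreal \<bar>\<psi> w (\<tau> w x)\<bar> \<partial>M)"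
        using w by (intro nn_integral_cmult) measurable
      also have "(\<integral>\<^sup>+x. ennreal \<bar>\<psi> w (\<tau> w x)\<bar> \<partial>M) = ?J w"
        using w by (intro nn_integral_step[where g = "\<lambda>x. ennreal \<bar>\<psi> w x\<bar>"]) measurable
      finally show "(\<integral>\<^sup>+x. ennreal (P v w) * ennreal \<bar>\<psi> w (\<tau> w x)\<bar> \<partial>M) = ennreal (P v w) * ?J w" .
    qed
    finally show ?thesis .
  qed
  then have "norm1 (markov \<psi>) \<le> (\<Sum>v\<in>V. ennreal (\<nu> v) * (\<Sum>w\<in>V. ennreal (P v w) * ?J w))"
    unfolding norm1_def by (intro sum_mono mult_left_mono) auto
  also have "\<dots> = (\<Sum>v\<in>V. \<Sum>w\<in>V. ennreal (\<nu> v * P v w) * ?J w)"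
    using \<nu>_pos P_nonneg
    by (intro sum.cong refl) (simp add: sum_distrib_left ennreal_mult less_imp_le mult.assoc)
  also have "\<dots> = (\<Sum>w\<in>V. (\<Sum>v\<in>V. ennreal (\<nu> v * P v w)) * ?J w)"
    by (subst sum.swap) (simp add: sum_distrib_right)
  also have "\<dots> = norm1 \<psi>"
    unfolding norm1_def
  proof (intro sum.cong refl arg_cong2[of _ _ _ _ "(*)"])
    fix w assume w: "w \<in> V"
    show "(\<Sum>v\<in>V. ennreal (\<nu> v * P v w)) = ennreal (\<nu> w)"
      using w \<nu>_pos P_nonneg by (subst sum_ennreal) (auto simp: \<nu>_stationary less_imp_le)
  qed
  finally show ?thesis .
qed

lemma markov_measurable:
  assumes [measurable]: "\<And>v. v \<in> V \<Longrightarrow> \<psi> v \<in> borel_measurable M"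
  shows "markov \<psi> v \<in> borel_measurable M"
  unfolding markov_def by measurable

lemma markov_pow_measurable:
  assumes "\<And>v. v \<in> V \<Longrightarrow> \<psi> v \<in> borel_measurable M" and "v \<in> V"
  shows "(markov ^^ n) \<psi> v \<in> borel_measurable M"
  using assms(2) by (induction n arbitrary: v) (simp_all add: assms(1) markov_measurable)

lemma norm1_markov_pow_le:
  assumes "\<And>v. v \<in> V \<Longrightarrow> \<psi> v \<in> borel_measurable M"
  shows "norm1 ((markov ^^ n) \<psi>) \<le> norm1 \<psi>"
proof (induction n)
  case (Suc n)
  have "norm1 (markov ((markov ^^ n) \<psi>)) \<le> norm1 ((markov ^^ n) \<psi>)"
    by (rule norm1_markov_le) (rule markov_pow_measurable[OF assms])
  from order_trans[OF this Suc.IH] show ?case by simp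
qed simp

end

section \<open>Spherical averages as powers of the Markov operator\<close>

lemma path_weight_snoc:
  "s \<noteq> [] \<Longrightarrow> path_weight P (s @ [v]) = path_weight P s * P v (last s)"
proof -
  assume "s \<noteq> []"
  then obtain n where n: "length s = Suc n" by (cases s) auto
  have "path_weight P (s @ [v]) = (\<Prod>i<n. P ((s @ [v]) ! Suc i) ((s @ [v]) ! i)) * P ((s @ [v]) ! Suc n) ((s @ [v]) ! n)"
    by (simp add: path_weight_def n)
  also have "(\<Prod>i<n. P ((s @ [v]) ! Suc i) ((s @ [v]) ! i)) = path_weight P s"
    by (simp add: path_weight_def n nth_append)
  also have "P ((s @ [v]) ! Suc n) ((s @ [v]) ! n) = P v (last s)"
    using \<open>s \<noteq> []\<close> n by (simp add: nth_append last_conv_nth)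
  finally show ?thesis .
qed

locale labelled_random_walk =
  stationary_random_maps M V P \<nu> "\<lambda>v. T (L v)" + group F
  for M :: "'x measure" and V :: "'v set" and P \<nu>
    and F :: "('g, 'm) monoid_scheme" (structure)
    and L :: "'v \<Rightarrow> 'g" and T :: "'g \<Rightarrow> 'x \<Rightarrow> 'x" +
  assumes label: "L \<in> V \<rightarrow> carrier F"
    and action: "pmp_action F M T"
begin

lemma path_label_closed: "set s \<subseteq> V \<Longrightarrow> path_label F L s \<in> carrier F"
  using label by (induction s) (auto simp: path_label_def)

lemma foldr_step_path_label:
  "set s \<subseteq> V \<Longrightarrow> x \<in> space M \<Longrightarrow> foldr (\<lambda>v. T (L v)) s x = T (path_label F L s) x"
proof (induction s)
  case Nil
  then show ?case
    using pmp_action_one[OF is_group action] by (simp add: path_label_def)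
next
  case (Cons w s)
  then have "L w \<in> carrier F" "path_label F L s \<in> carrier F"
    using label path_label_closed by auto
  with Cons pmp_action_mult[OF is_group action this] show ?case
    by (simp add: path_label_def)
qed

text \<open>One more application of \<open>markov\<close> applies its map before those already present, which appends a
  vertex at the end of the path. The state \<open>v\<close> of the chain is the vertex visited just before the
  path is traversed from its end, hence the weight of \<open>s @ [v]\<close>.\<close>

lemma markov_pow_eq_path_sum:
  assumes "v \<in> V" "x \<in> space M"
  shows "(markov ^^ n) (\<lambda>_. f) v x
    = (\<Sum>s | s \<in> lists V \<and> length s = n. path_weight P (s @ [v]) * f (T (path_label F L s) x))"
  using assms
proof (induction n arbitrary: v x)
  case 0
  have "{s. s \<in> lists V \<and> s = []} = {[]}" by auto
  then show ?case
    using 0 pmp_action_one[OF is_group action] by (simp add: path_weight_def path_label_def)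
next
  case (Suc n)
  define paths where "paths m = {s. s \<in> lists V \<and> length s = m}" for m
  have inj: "inj_on (\<lambda>(w, s). s @ [w]) (V \<times> paths n)"
    by (auto simp: inj_on_def)
  have img: "paths (Suc n) = (\<lambda>(w, s). s @ [w]) ` (V \<times> paths n)"
  proof (intro Set.set_eqI iffI)
    fix s assume "s \<in> paths (Suc n)"
    then have "s \<noteq> []" "s \<in> lists V" "length s = Suc n" by (auto simp: paths_def)
    then show "s \<in> (\<lambda>(w, s). s @ [w]) ` (V \<times> paths n)"
      by (intro image_eqI[of _ _ "(last s, butlast s)"])
        (auto simp: paths_def dest: in_set_butlastD)
  qed (auto simp: paths_def)
  have step: "T (path_label F L s) (T (L w) x) = T (path_label F L (s @ [w])) x"
    if "w \<in> V" "s \<in> paths n" for w s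
  proof -
    have sub: "set s \<subseteq> V" using that by (auto simp: paths_def)
    have "T (path_label F L s) (T (L w) x) = foldr (\<lambda>v. T (L v)) s (T (L w) x)"
      using foldr_step_path_label[OF sub] measurable_space[OF measurable_step[OF that(1)] Suc.prems(2)] by simp
    also have "\<dots> = foldr (\<lambda>v. T (L v)) (s @ [w]) x" by simp
    also have "\<dots> = T (path_label F L (s @ [w])) x"
      using sub that Suc.prems(2) by (intro foldr_step_path_label) auto
    finally show ?thesis .
  qed
  have "(markov ^^ Suc n) (\<lambda>_. f) v x
      = (\<Sum>w\<in>V. P v w * (\<Sum>s\<in>paths n. path_weight P (s @ [w]) * f (T (path_label F L s) (T (L w) x))))"
  proof -
    have "(markov ^^ Suc n) (\<lambda>_. f) v x = (\<Sum>w\<in>V. P v w * (markov ^^ n) (\<lambda>_. f) w (T (L w) x))"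
      unfolding funpow.simps comp_apply by (rule markov_def)
    then show ?thesis
      using Suc.IH measurable_space[OF measurable_step Suc.prems(2)]
      by (simp add: paths_def cong: sum.cong)
  qed
  also have "\<dots> = (\<Sum>w\<in>V. \<Sum>s\<in>paths n. path_weight P ((s @ [w]) @ [v]) * f (T (path_label F L (s @ [w])) x))"
    using path_weight_snoc[of "_ @ [_]" P v] step
    by (intro sum.cong refl) (simp add: sum_distrib_left mult_ac cong: sum.cong)
  also have "\<dots> = (\<Sum>(w, s)\<in>V \<times> paths n. path_weight P ((s @ [w]) @ [v]) * f (T (path_label F L (s @ [w])) x))"
    by (rule sum.cartesian_product)
  also have "\<dots> = (\<Sum>s\<in>paths (Suc n). path_weight P (s @ [v]) * f (T (path_label F L s) x))"
    unfolding img by (subst sum.reindex[OF inj]) (simp add: case_prod_unfold)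
  finally show ?case by (simp add: paths_def)
qed

text \<open>Summing the transition from \<open>v\<close> to the last vertex of \<open>s\<close> against \<open>\<nu>\<close> gives \<open>\<nu> (last s)\<close>, by
  stationarity.\<close>

lemma spherical_average_eq_markov:
  assumes "n \<ge> 1" and x: "x \<in> space M"
  shows "spherical_average F V L P \<nu> T n f x = (\<Sum>v\<in>V. \<nu> v * (markov ^^ n) (\<lambda>_. f) v x)"
proof -
  let ?S = "{s. s \<in> lists V \<and> length s = n}"
  let ?f = "\<lambda>s. f (T (path_label F L s) x)"
  have "(\<Sum>v\<in>V. \<nu> v * (markov ^^ n) (\<lambda>_. f) v x)
      = (\<Sum>v\<in>V. \<Sum>s\<in>?S. \<nu> v * (path_weight P (s @ [v]) * ?f s))"
    using x by (simp add: markov_pow_eq_path_sum sum_distrib_left cong: sum.cong)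
  also have "\<dots> = (\<Sum>s\<in>?S. \<Sum>v\<in>V. \<nu> v * (path_weight P (s @ [v]) * ?f s))"
    by (rule sum.swap)
  also have "\<dots> = (\<Sum>s\<in>?S. \<nu> (last s) * path_weight P s * ?f s)"
  proof (rule sum.cong[OF refl])
    fix s assume s: "s \<in> ?S"
    then have "s \<noteq> []" "set s \<subseteq> V" using \<open>n \<ge> 1\<close> by auto
    then have "last s \<in> V" using last_in_set by blast
    have "(\<Sum>v\<in>V. \<nu> v * (path_weight P (s @ [v]) * ?f s))
        = (\<Sum>v\<in>V. \<nu> v * P v (last s)) * (path_weight P s * ?f s)"
      unfolding sum_distrib_right
      by (intro sum.cong refl) (simp add: path_weight_snoc[OF \<open>s \<noteq> []\<close>] mult_ac)
    then show "(\<Sum>v\<in>V. \<nu> v * (path_weight P (s @ [v]) * ?f s)) = \<nu> (last s) * path_weight P s * ?f s"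
      using \<open>last s \<in> V\<close> by (simp add: \<nu>_stationary)
  qed
  finally show ?thesis by (simp add: spherical_average_def)
qed

lemma spherical_window_eq_markov:
  assumes "n \<ge> 1" "N \<ge> 1" and x: "x \<in> space M"
  shows "1 / real N * (\<Sum>i = 0..N - 1. spherical_average F V L P \<nu> T (n + i) f x)
    = (\<Sum>v\<in>V. \<nu> v * (markov ^^ n) (window_average N f) v x)"
proof -
  have "{0..N - 1} = {..<N}" using \<open>N \<ge> 1\<close> by auto
  then have "1 / real N * (\<Sum>i = 0..N - 1. spherical_average F V L P \<nu> T (n + i) f x)
      = 1 / real N * (\<Sum>i<N. \<Sum>v\<in>V. \<nu> v * (markov ^^ (n + i)) (\<lambda>_. f) v x)"
    using assms by (simp add: spherical_average_eq_markov)
  also have "\<dots> = (\<Sum>v\<in>V. \<nu> v * (1 / real N * (\<Sum>i<N. (markov ^^ (n + i)) (\<lambda>_. f) v x)))"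
    by (subst sum.swap) (simp add: sum_distrib_left mult.left_commute)
  finally show ?thesis
    by (simp add: markov_pow_window_average)
qed

section \<open>Invariance of the limit\<close>

lemma L2_asymptotic_action_generate:
  assumes meas: "\<And>n. a n \<in> borel_measurable M" and S: "S \<subseteq> carrier F"
    and inv: "\<And>g. g \<in> S \<Longrightarrow> L2_asymptotic M (\<lambda>n x. a n (T g x)) a"
    and "g \<in> generate F S"
  shows "L2_asymptotic M (\<lambda>n x. a n (T g x)) a"
  using assms(4)
proof induction
  case one
  show ?case
    by (rule L2_asymptotic_cong[OF L2_asymptotic_refl[OF meas]])
      (simp_all add: pmp_action_one[OF is_group action])
next
  case (incl h)
  then show ?case by (rule inv)
next
  case (inv h)
  then have h: "h \<in> carrier F" using S by auto
  then have h': "inv h \<in> carrier F" by simp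
  from L2_asymptotic_compose[OF assms(3)[OF inv] pmp_action_measurable[OF is_group action h']
      pmp_action_distr[OF is_group action h']]
  have "L2_asymptotic M (\<lambda>n x. a n (T h (T (inv h) x))) (\<lambda>n x. a n (T (inv h) x))" .
  then have "L2_asymptotic M a (\<lambda>n x. a n (T (inv h) x))"
    by (rule L2_asymptotic_cong) (simp_all add: pmp_action_inv[OF is_group action h])
  then show ?case by (rule L2_asymptotic_sym)
next
  case (eng g h)
  then have g: "g \<in> carrier F" and h: "h \<in> carrier F"
    using generate_incl[OF S] by auto
  from L2_asymptotic_compose[OF eng.IH(1) pmp_action_measurable[OF is_group action h]
      pmp_action_distr[OF is_group action h]]
  have "L2_asymptotic M (\<lambda>n x. a n (T g (T h x))) (\<lambda>n x. a n (T h x))" .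
  from L2_asymptotic_trans[OF this eng.IH(2)]
  show ?case
    by (rule L2_asymptotic_cong) (simp_all add: pmp_action_mult[OF is_group action g h])
qed

text \<open>A loop at \<open>v\<close> relates the orbit value at \<open>v\<close> to a delayed copy of itself composed with the map of
  the loop label; the delay is harmless when increments vanish.\<close>

lemma L2_asymptotic_orbit_loop_group:
  assumes \<psi>: "\<psi> \<in> bounded_obs" and v: "v \<in> V"
    and slow: "L2_asymptotic M (\<lambda>n. (markov ^^ Suc n) \<psi> v) (\<lambda>n. (markov ^^ n) \<psi> v)"
    and g: "g \<in> loop_group F V L P v"
  shows "L2_asymptotic M (\<lambda>n x. (markov ^^ n) \<psi> v (T g x)) (\<lambda>n. (markov ^^ n) \<psi> v)"
proof (rule L2_asymptotic_action_generate[OF _ _ _ g[unfolded loop_group_def]])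
  fix h assume "h \<in> path_label F L ` {p. p \<noteq> [] \<and> directed_path V P p \<and> hd p = v \<and> (last p, v) \<in> edges V P}"
  then obtain p where h: "h = path_label F L p" and p: "p \<noteq> []" "directed_path V P p" "hd p = v"
    "(last p, v) \<in> edges V P" by auto
  then have sub: "set p \<subseteq> V" by (auto simp: directed_path_def)
  have "directed_path V P (p @ [v])"
    using p v by (auto simp: directed_path_def successively_append_iff)
  from L2_asymptotic_orbit_path[OF \<psi> this]
  have "L2_asymptotic M (\<lambda>n. (markov ^^ (n + length p)) \<psi> v)
      (\<lambda>n x. (markov ^^ n) \<psi> v (foldr (\<lambda>v. T (L v)) p x))"
    using p by simp
  then have "L2_asymptotic M (\<lambda>n. (markov ^^ (n + length p)) \<psi> v) (\<lambda>n x. (markov ^^ n) \<psi> v (T h x))"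
    by (rule L2_asymptotic_cong) (simp_all add: h foldr_step_path_label[OF sub])
  then show "L2_asymptotic M (\<lambda>n x. (markov ^^ n) \<psi> v (T h x)) (\<lambda>n. (markov ^^ n) \<psi> v)"
    by (intro L2_asymptotic_trans[OF L2_asymptotic_sym L2_asymptotic_iterate[OF slow]])
next
  show "path_label F L ` {p. p \<noteq> [] \<and> directed_path V P p \<and> hd p = v \<and> (last p, v) \<in> edges V P} \<subseteq> carrier F"
    using path_label_closed by (auto simp: directed_path_def)
qed (rule bounded_obs_measurable[OF bounded_obs_markov_pow[OF \<psi>] v])

text \<open>A path from \<open>u\<close> to \<open>v\<close> relates the orbit values at its ends up to a group element and a delay,
  and neither matters in the limit.\<close>

lemma L2_asymptotic_orbit_vertices:
  assumes \<psi>: "\<psi> \<in> bounded_obs" and u: "u \<in> V" and v: "v \<in> V"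
    and "strongly_connected_graph V P"
    and slow: "L2_asymptotic M (\<lambda>n. (markov ^^ Suc n) \<psi> v) (\<lambda>n. (markov ^^ n) \<psi> v)"
    and inv: "\<And>g. g \<in> carrier F \<Longrightarrow>
      L2_asymptotic M (\<lambda>n x. (markov ^^ n) \<psi> u (T g x)) (\<lambda>n. (markov ^^ n) \<psi> u)"
  shows "L2_asymptotic M (\<lambda>n. (markov ^^ n) \<psi> v) (\<lambda>n. (markov ^^ n) \<psi> u)"
proof -
  obtain s where s: "directed_path V P (s @ [v])" "hd (s @ [v]) = u"
    using directed_path_to assms(4) u v unfolding strongly_connected_graph_def by metis
  then have sub: "set s \<subseteq> V" by (auto simp: directed_path_def)
  have "L2_asymptotic M (\<lambda>n. (markov ^^ (n + length s)) \<psi> v)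
      (\<lambda>n x. (markov ^^ n) \<psi> u (foldr (\<lambda>v. T (L v)) s x))"
    using L2_asymptotic_orbit_path[OF \<psi> s(1)] s(2) by simp
  then have "L2_asymptotic M (\<lambda>n. (markov ^^ (n + length s)) \<psi> v)
      (\<lambda>n x. (markov ^^ n) \<psi> u (T (path_label F L s) x))"
    by (rule L2_asymptotic_cong) (simp_all add: foldr_step_path_label[OF sub])
  from L2_asymptotic_trans[OF this inv[OF path_label_closed[OF sub]]]
  show ?thesis
    by (rule L2_asymptotic_trans[OF L2_asymptotic_sym[OF L2_asymptotic_iterate[OF slow]]])
qed

end

section \<open>Convergence for bounded functions\<close>

context labelled_random_walk
begin

text \<open>All \<open>a n v\<close> have the same limit \<open>r\<close> in square mean, and \<open>r\<close> is almost everywhere invariant. The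
  means over \<open>v\<close> of the integrals of \<open>a n v\<close> over an invariant set do not depend on \<open>n\<close>, so \<open>r\<close> and
  \<open>f\<close> have equal integrals over it. A strictly invariant version of \<open>r\<close> is thus a conditional
  expectation of \<open>f\<close>.\<close>

lemma bounded_window_converges:
  assumes "admissible F V L P k" and k: "k \<ge> 1" and countable: "countable (carrier F)"
    and f: "f \<in> borel_measurable M" "\<And>x. x \<in> space M \<Longrightarrow> \<bar>f x\<bar> \<le> C"
  shows "(\<lambda>n. \<integral>\<^sup>+ x. ennreal \<bar>(\<Sum>v\<in>V. \<nu> v * (markov ^^ n) (window_average (2 * k) f) v x)
           - real_cond_exp M (invariant_algebra F M T) f x\<bar> \<partial>M) \<longlonglongrightarrow> 0"
proof -
  have f_obs: "(\<lambda>_. f) \<in> bounded_obs"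
    using f by (rule bounded_obs_const)
  define a where "a n = (markov ^^ n) (window_average (2 * k) f)" for n
  note w_obs = bounded_obs_window_average[OF f_obs, of "2 * k"]
  have a: "a n \<in> bounded_obs" for n
    unfolding a_def by (rule bounded_obs_markov_pow[OF w_obs])
  note [measurable] = bounded_obs_measurable[OF a]
  obtain u w p q p' q' where good:
    "directed_path V P ([u] @ p @ [w])" "directed_path V P ([u] @ q @ [w])"
    "directed_path V P (p @ q' @ p)" "length p = k" "length q = k" "length q' = k"
    and q': "directed_path V P q" "directed_path V P q'" "path_label F L q' = inv (path_label F L q)"
    using assms(1) unfolding admissible_def good_subgraph_def by blast
  have sc: "strongly_connected_graph V P"
    using assms(1) by (simp add: admissible_def)
  obtain v0 where v0: "v0 \<in> V" "loop_group F V L P v0 = carrier F"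
    using assms(1) by (auto simp: admissible_def)
  have q_V: "set q \<subseteq> V" "set q' \<subseteq> V"
    using q' by (auto simp: directed_path_def)
  have qq': "foldr (\<lambda>v. T (L v)) q (foldr (\<lambda>v. T (L v)) q' x) = x" if x: "x \<in> space M" for x
  proof -
    have "foldr (\<lambda>v. T (L v)) q' x \<in> space M"
      using measurable_space[OF measurable_foldr_step[OF q_V(2)] x] .
    then show ?thesis
      using pmp_action_inv(2)[OF is_group action path_label_closed[OF q_V(1)] x]
      by (simp add: foldr_step_path_label[OF q_V(1)] foldr_step_path_label[OF q_V(2) x] q'(3))
  qed
  have slow: "L2_asymptotic M (\<lambda>n. a (Suc n) v) (\<lambda>n. a n v)" if v: "v \<in> V" for v
    unfolding a_def
    by (rule L2_asymptotic_window_average[OF f_obs v L2_asymptotic_orbit_period[OF f_obs sc good k qq' v]])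
  have inv: "L2_asymptotic M (\<lambda>n x. a n v0 (T g x)) (\<lambda>n. a n v0)" if "g \<in> carrier F" for g
  proof -
    have "g \<in> loop_group F V L P v0"
      unfolding v0(2) by (rule that)
    from L2_asymptotic_orbit_loop_group[OF w_obs v0(1) slow[OF v0(1), unfolded a_def] this]
    show ?thesis by (simp only: a_def)
  qed
  obtain r where r: "L2_asymptotic M (\<lambda>n. a n v0) (\<lambda>_. r)"
    by (rule L2_convergent_orbit[OF w_obs _ v0(1)])
      (rule slow[unfolded a_def], assumption, rule that, simp only: a_def)
  have lim: "L2_asymptotic M (\<lambda>n. a n v) (\<lambda>_. r)" if v: "v \<in> V" for v
    unfolding a_def
    by (rule L2_asymptotic_trans[OF L2_asymptotic_orbit_vertices[OF w_obs v0(1) v sc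
          slow[OF v, unfolded a_def] inv[unfolded a_def]] r[unfolded a_def]])
  have r_meas [measurable]: "r \<in> borel_measurable M"
    using r by (simp add: L2_asymptotic_def)
  have r_int: "integrable M r"
    using integrable_L2_limit[OF r] bounded_obs_integrable[OF a v0(1)] by blast
  have "AE x in M. r (T g x) = r x" if g: "g \<in> carrier F" for g
  proof (rule L2_asymptotic_const_AE)
    from L2_asymptotic_compose[OF r pmp_action_measurable[OF is_group action g]
        pmp_action_distr[OF is_group action g]]
    have "L2_asymptotic M (\<lambda>n x. a n v0 (T g x)) (\<lambda>_ x. r (T g x))" .
    from L2_asymptotic_trans[OF L2_asymptotic_sym[OF this] L2_asymptotic_trans[OF inv[OF g] r]]
    show "L2_asymptotic M (\<lambda>_ x. r (T g x)) (\<lambda>_. r)" .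
  qed
  then obtain r' where r': "r' \<in> borel_measurable (invariant_algebra F M T)" "AE x in M. r' x = r x"
    using AE_invariant_strictly_invariant[OF is_group action r_meas countable] by blast
  let ?\<theta> = "\<lambda>n x. \<Sum>v\<in>V. \<nu> v * a n v x"
  have L1: "(\<lambda>n. \<integral>\<^sup>+ x. ennreal \<bar>?\<theta> n x - r x\<bar> \<partial>M) \<longlonglongrightarrow> 0"
  proof -
    have "?\<theta> n x - r x = (\<Sum>v\<in>V. \<nu> v * (a n v x - r x))" for n x
      by (simp add: right_diff_distrib sum_subtractf sum_distrib_right[symmetric] \<nu>_sum)
    then have le: "(\<integral>\<^sup>+ x. ennreal \<bar>?\<theta> n x - r x\<bar> \<partial>M) \<le> norm1 (\<lambda>v x. a n v x - r x)" for n
      using nn_integral_mean_le[of "\<lambda>v x. a n v x - r x"] by simp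
    have "(\<lambda>n. norm1 (\<lambda>v x. a n v x - r x)) \<longlonglongrightarrow> (\<Sum>v\<in>V. ennreal (\<nu> v) * 0)"
      unfolding norm1_def
    proof (rule tendsto_sum)
      fix v assume "v \<in> V"
      from L2_asymptotic_imp_L1[OF lim[OF this]]
      show "(\<lambda>n. ennreal (\<nu> v) * (\<integral>\<^sup>+ x. ennreal \<bar>a n v x - r x\<bar> \<partial>M)) \<longlonglongrightarrow> ennreal (\<nu> v) * 0"
        by (rule ennreal_tendsto_cmult[rotated]) simp
    qed
    then have "(\<lambda>n. norm1 (\<lambda>v x. a n v x - r x)) \<longlonglongrightarrow> 0"
      by simp
    from tendsto_0_le_ennreal[OF le this] show ?thesis .
  qed
  have subalg: "subalgebra M (invariant_algebra F M T)"
    by (rule subalgebra_invariant_algebra[OF action])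
  interpret fin: finite_measure_subalgebra M "invariant_algebra F M T"
    by (unfold_locales) (rule subalg)
  have "AE x in M. real_cond_exp M (invariant_algebra F M T) f x = r' x"
  proof (rule fin.real_cond_exp_charact)
    show "integrable M f"
      using bounded_obs_integrable[OF f_obs v0(1)] .
    show "integrable M r'"
      using r' r_int measurable_from_subalg[OF subalg r'(1)] by (subst integrable_cong_AE) auto
    fix A assume "A \<in> sets (invariant_algebra F M T)"
    then have A: "A \<in> sets M" and A_inv: "\<And>g. g \<in> carrier F \<Longrightarrow> T g -` A \<inter> space M = A"
      using sets_invariant_algebra[OF action] by auto
    have A_step: "T (L w) -` A \<inter> space M = A" if "w \<in> V" for w
      using A_inv label that by auto
    have set_lim: "(\<lambda>n. \<integral>x\<in>A. a n v x \<partial>M) \<longlonglongrightarrow> (\<integral>x\<in>A. r x \<partial>M)" if v: "v \<in> V" for v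
      unfolding set_lebesgue_integral_def
    proof (rule tendsto_L1_int)
      show "integrable M (\<lambda>x. indicator A x *\<^sub>R a n v x)" for n
        using integrable_mult_indicator[OF A bounded_obs_integrable[OF a v]] .
      show "integrable M (\<lambda>x. indicator A x *\<^sub>R r x)"
        using integrable_mult_indicator[OF A r_int] .
      show "(\<lambda>n. \<integral>\<^sup>+ x. ennreal (norm (indicator A x *\<^sub>R a n v x - indicator A x *\<^sub>R r x)) \<partial>M) \<longlonglongrightarrow> 0"
      proof (rule tendsto_0_le_ennreal[OF _ L2_asymptotic_imp_L1[OF lim[OF v]]])
        show "(\<integral>\<^sup>+ x. ennreal (norm (indicator A x *\<^sub>R a n v x - indicator A x *\<^sub>R r x)) \<partial>M)
          \<le> (\<integral>\<^sup>+ x. ennreal \<bar>a n v x - r x\<bar> \<partial>M)" for n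
          by (intro nn_integral_mono) (auto simp: indicator_def)
      qed
    qed
    have "(\<lambda>n. \<Sum>v\<in>V. \<nu> v * (\<integral>x\<in>A. a n v x \<partial>M)) \<longlonglongrightarrow> (\<Sum>v\<in>V. \<nu> v * (\<integral>x\<in>A. r x \<partial>M))"
      by (intro tendsto_sum tendsto_mult_left set_lim)
    moreover have "(\<Sum>v\<in>V. \<nu> v * (\<integral>x\<in>A. a n v x \<partial>M)) = (\<integral>x\<in>A. f x \<partial>M)" for n
      unfolding a_def using k by (intro set_mean_window_average[OF f_obs A _ A_step]) auto
    ultimately have "(\<integral>x\<in>A. f x \<partial>M) = (\<integral>x\<in>A. r x \<partial>M)"
      by (simp add: sum_distrib_right[symmetric] \<nu>_sum LIMSEQ_const_iff)
    also have "\<dots> = (\<integral>x\<in>A. r' x \<partial>M)"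
      unfolding set_lebesgue_integral_def
      using r'(2) measurable_from_subalg[OF subalg r'(1)] A
      by (intro integral_cong_AE) auto
    finally show "(\<integral>x\<in>A. f x \<partial>M) = (\<integral>x\<in>A. r' x \<partial>M)" .
  qed (rule r'(1))
  with r'(2) have "AE x in M. real_cond_exp M (invariant_algebra F M T) f x = r x"
    by eventually_elim simp
  then have "(\<integral>\<^sup>+ x. ennreal \<bar>?\<theta> n x - real_cond_exp M (invariant_algebra F M T) f x\<bar> \<partial>M)
      = (\<integral>\<^sup>+ x. ennreal \<bar>?\<theta> n x - r x\<bar> \<partial>M)" for n
    by (intro nn_integral_cong_AE) auto
  with L1 show ?thesis
    by (simp add: a_def)
qed

end

section \<open>Convergence for integrable functions\<close>

lemma (in prob_space) real_cond_exp_L1_contraction: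
  assumes "subalgebra M G" and f: "integrable M f" and g: "integrable M g"
  shows "(\<integral>\<^sup>+ x. ennreal \<bar>real_cond_exp M G f x - real_cond_exp M G g x\<bar> \<partial>M)
    \<le> (\<integral>\<^sup>+ x. ennreal \<bar>f x - g x\<bar> \<partial>M)"
proof -
  interpret fin: finite_measure_subalgebra M G
    by unfold_locales (rule assms(1))
  have [measurable]: "f \<in> borel_measurable M" "g \<in> borel_measurable M"
    using f g by auto
  have "AE x in M. ennreal \<bar>real_cond_exp M G f x - real_cond_exp M G g x\<bar>
      \<le> nn_cond_exp M G (\<lambda>x. ennreal \<bar>f x - g x\<bar>) x"
    using fin.real_cond_exp_diff[OF f g] fin.real_cond_exp_abs[of "\<lambda>x. f x - g x"]
    by (auto elim: eventually_elim2)
  then have "(\<integral>\<^sup>+ x. ennreal \<bar>real_cond_exp M G f x - real_cond_exp M G g x\<bar> \<partial>M)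
      \<le> (\<integral>\<^sup>+ x. nn_cond_exp M G (\<lambda>x. ennreal \<bar>f x - g x\<bar>) x \<partial>M)"
    by (rule nn_integral_mono_AE)
  also have "\<dots> = (\<integral>\<^sup>+ x. ennreal \<bar>f x - g x\<bar> \<partial>M)"
    using fin.nn_cond_exp_intg[of "\<lambda>_. 1" "\<lambda>x. ennreal \<bar>f x - g x\<bar>"] by simp
  finally show ?thesis .
qed

lemma truncation_tendsto_L1:
  fixes f :: "'x \<Rightarrow> real"
  assumes f: "integrable M f"
  shows "(\<lambda>j. \<integral>\<^sup>+ x. ennreal \<bar>f x - max (- real j) (min (real j) (f x))\<bar> \<partial>M) \<longlonglongrightarrow> 0"
proof -
  have [measurable]: "f \<in> borel_measurable M" using f by auto
  have "(\<lambda>j. \<integral>\<^sup>+ x. ennreal \<bar>f x - max (- real j) (min (real j) (f x))\<bar> \<partial>M) \<longlonglongrightarrow> (\<integral>\<^sup>+ x. 0 \<partial>M)"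
  proof (rule nn_integral_dominated_convergence[where w = "\<lambda>x. ennreal \<bar>f x\<bar>"])
    show "(\<integral>\<^sup>+ x. ennreal \<bar>f x\<bar> \<partial>M) < \<infinity>"
      using f by (simp add: integrable_iff_bounded)
    show "AE x in M. ennreal \<bar>f x - max (- real j) (min (real j) (f x))\<bar> \<le> ennreal \<bar>f x\<bar>" for j
      by (intro AE_I2 ennreal_leI) (auto simp: max_def min_def)
    show "AE x in M. (\<lambda>j. ennreal \<bar>f x - max (- real j) (min (real j) (f x))\<bar>) \<longlonglongrightarrow> 0"
    proof (rule AE_I2)
      fix x
      obtain N where N: "\<bar>f x\<bar> \<le> real N" using real_arch_simple by blast
      have "\<forall>\<^sub>F j in sequentially. ennreal \<bar>f x - max (- real j) (min (real j) (f x))\<bar> = 0"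
        using eventually_ge_at_top[of N]
      proof eventually_elim
        case (elim j)
        then have "\<bar>f x\<bar> \<le> real j" using N by linarith
        then show ?case by (auto simp: max_def min_def)
      qed
      then show "(\<lambda>j. ennreal \<bar>f x - max (- real j) (min (real j) (f x))\<bar>) \<longlonglongrightarrow> 0"
        by (rule tendsto_eventually)
    qed
  qed auto
  then show ?thesis by simp
qed

context labelled_random_walk
begin

lemma mean_window_L1_contraction:
  assumes "integrable M f" "integrable M g" and N: "N > 0"
  shows "(\<integral>\<^sup>+ x. ennreal \<bar>(\<Sum>v\<in>V. \<nu> v * (markov ^^ n) (window_average N f) v x)
            - (\<Sum>v\<in>V. \<nu> v * (markov ^^ n) (window_average N g) v x)\<bar> \<partial>M)
       \<le> (\<integral>\<^sup>+ x. ennreal \<bar>f x - g x\<bar> \<partial>M)" (is "?lhs \<le> ?rhs")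
proof -
  have [measurable]: "f \<in> borel_measurable M" "g \<in> borel_measurable M"
    using assms by auto
  define \<phi> where "\<phi> = (\<lambda>(_::'v) x. f x - g x)"
  define \<psi> where "\<psi> i = (markov ^^ (n + i)) \<phi>" for i
  have \<phi>_meas: "\<phi> v \<in> borel_measurable M" for v
    by (simp add: \<phi>_def)
  have \<psi>_meas [measurable]: "\<psi> i v \<in> borel_measurable M" if "v \<in> V" for i v
    unfolding \<psi>_def using \<phi>_meas that by (rule markov_pow_measurable)
  have mean: "(\<integral>\<^sup>+x. ennreal \<bar>\<Sum>v\<in>V. \<nu> v * \<psi> i v x\<bar> \<partial>M) \<le> ?rhs" for i
  proof -
    have "(\<integral>\<^sup>+x. ennreal \<bar>\<Sum>v\<in>V. \<nu> v * \<psi> i v x\<bar> \<partial>M) \<le> norm1 (\<psi> i)"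
      by (rule nn_integral_mean_le) (rule \<psi>_meas)
    also have "\<dots> \<le> norm1 \<phi>"
      unfolding \<psi>_def by (rule norm1_markov_pow_le[OF \<phi>_meas])
    also have "\<dots> = (\<Sum>v\<in>V. ennreal (\<nu> v)) * ?rhs"
      by (simp add: norm1_def \<phi>_def sum_distrib_right)
    also have "(\<Sum>v\<in>V. ennreal (\<nu> v)) = 1"
      using \<nu>_pos by (subst sum_ennreal) (auto simp: \<nu>_sum less_imp_le)
    finally show ?thesis by simp
  qed
  have "(\<Sum>v\<in>V. \<nu> v * (markov ^^ n) (window_average N f) v x)
      - (\<Sum>v\<in>V. \<nu> v * (markov ^^ n) (window_average N g) v x)
      = 1 / real N * (\<Sum>i<N. \<Sum>v\<in>V. \<nu> v * \<psi> i v x)" for x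
  proof -
    have "(\<Sum>v\<in>V. \<nu> v * (markov ^^ n) (window_average N f) v x)
        - (\<Sum>v\<in>V. \<nu> v * (markov ^^ n) (window_average N g) v x)
        = (\<Sum>v\<in>V. \<nu> v * (1 / real N * (\<Sum>i<N. \<psi> i v x)))"
      unfolding markov_pow_window_average \<psi>_def \<phi>_def markov_pow_diff
      by (simp only: sum_subtractf right_diff_distrib)
    also have "\<dots> = 1 / real N * (\<Sum>v\<in>V. \<Sum>i<N. \<nu> v * \<psi> i v x)"
      by (simp add: sum_distrib_left mult.left_commute)
    also have "\<dots> = 1 / real N * (\<Sum>i<N. \<Sum>v\<in>V. \<nu> v * \<psi> i v x)"
      by (subst sum.swap) (rule refl)
    finally show ?thesis .
  qed
  then have "?lhs = (\<integral>\<^sup>+x. ennreal \<bar>1 / real N * (\<Sum>i<N. \<Sum>v\<in>V. \<nu> v * \<psi> i v x)\<bar> \<partial>M)"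
    by simp
  also have "\<dots> \<le> (\<integral>\<^sup>+x. ennreal (1 / real N) * (\<Sum>i<N. ennreal \<bar>\<Sum>v\<in>V. \<nu> v * \<psi> i v x\<bar>) \<partial>M)"
  proof (rule nn_integral_mono)
    fix x
    have "\<bar>1 / real N * (\<Sum>i<N. \<Sum>v\<in>V. \<nu> v * \<psi> i v x)\<bar>
        \<le> 1 / real N * (\<Sum>i<N. \<bar>\<Sum>v\<in>V. \<nu> v * \<psi> i v x\<bar>)"
      unfolding abs_mult by (intro mult_mono sum_abs) auto
    then have "ennreal \<bar>1 / real N * (\<Sum>i<N. \<Sum>v\<in>V. \<nu> v * \<psi> i v x)\<bar>
        \<le> ennreal (1 / real N * (\<Sum>i<N. \<bar>\<Sum>v\<in>V. \<nu> v * \<psi> i v x\<bar>))"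
      by (rule ennreal_leI)
    also have "\<dots> = ennreal (1 / real N) * ennreal (\<Sum>i<N. \<bar>\<Sum>v\<in>V. \<nu> v * \<psi> i v x\<bar>)"
      by (rule ennreal_mult) (auto intro: sum_nonneg)
    also have "ennreal (\<Sum>i<N. \<bar>\<Sum>v\<in>V. \<nu> v * \<psi> i v x\<bar>) = (\<Sum>i<N. ennreal \<bar>\<Sum>v\<in>V. \<nu> v * \<psi> i v x\<bar>)"
      by (rule sum_ennreal[symmetric]) auto
    finally show "ennreal \<bar>1 / real N * (\<Sum>i<N. \<Sum>v\<in>V. \<nu> v * \<psi> i v x)\<bar>
        \<le> ennreal (1 / real N) * (\<Sum>i<N. ennreal \<bar>\<Sum>v\<in>V. \<nu> v * \<psi> i v x\<bar>)" .
  qed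
  also have "\<dots> = ennreal (1 / real N) * (\<Sum>i<N. \<integral>\<^sup>+x. ennreal \<bar>\<Sum>v\<in>V. \<nu> v * \<psi> i v x\<bar> \<partial>M)"
  proof -
    have "(\<integral>\<^sup>+x. (\<Sum>i<N. ennreal \<bar>\<Sum>v\<in>V. \<nu> v * \<psi> i v x\<bar>) \<partial>M)
        = (\<Sum>i<N. \<integral>\<^sup>+x. ennreal \<bar>\<Sum>v\<in>V. \<nu> v * \<psi> i v x\<bar> \<partial>M)"
      by (rule nn_integral_sum) measurable
    moreover have "(\<integral>\<^sup>+x. ennreal (1 / real N) * (\<Sum>i<N. ennreal \<bar>\<Sum>v\<in>V. \<nu> v * \<psi> i v x\<bar>) \<partial>M)
        = ennreal (1 / real N) * (\<integral>\<^sup>+x. (\<Sum>i<N. ennreal \<bar>\<Sum>v\<in>V. \<nu> v * \<psi> i v x\<bar>) \<partial>M)"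
      by (rule nn_integral_cmult) measurable
    ultimately show ?thesis by (simp only:)
  qed
  also have "\<dots> \<le> ennreal (1 / real N) * (\<Sum>i<N. ?rhs)"
    by (intro mult_left_mono sum_mono mean) auto
  also have "\<dots> = ennreal (1 / real N) * of_nat N * ?rhs"
    by (simp add: mult.assoc)
  also have "ennreal (1 / real N) * of_nat N = 1"
    using N by (simp add: ennreal_of_nat_eq_real_of_nat ennreal_mult[symmetric])
  finally show ?thesis by simp
qed

text \<open>Both sides contract the \<open>L\<^sup>1\<close>-distance, so replacing \<open>f\<close> by a truncation \<open>g\<close> costs at most the
  distance of \<open>f\<close> and \<open>g\<close> on each side.\<close>

lemma integrable_window_converges:
  assumes "admissible F V L P k" and k: "k \<ge> 1" and countable: "countable (carrier F)"
    and f: "integrable M f"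
  shows "(\<lambda>n. \<integral>\<^sup>+ x. ennreal \<bar>(\<Sum>v\<in>V. \<nu> v * (markov ^^ n) (window_average (2 * k) f) v x)
           - real_cond_exp M (invariant_algebra F M T) f x\<bar> \<partial>M) \<longlonglongrightarrow> 0"
    (is "(\<lambda>n. ?D n) \<longlonglongrightarrow> 0")
proof (rule order_tendstoI)
  fix e :: ennreal assume "0 < e"
  then obtain d where d: "0 < d" "ennreal d < e"
    by (rule ennreal_real_between)
  define t where "t j x = max (- real j) (min (real j) (f x))" for j x
  define \<theta> where "\<theta> h n x = (\<Sum>v\<in>V. \<nu> v * (markov ^^ n) (window_average (2 * k) h) v x)" for h n x
  define E where "E h = real_cond_exp M (invariant_algebra F M T) h" for h
  have [measurable]: "f \<in> borel_measurable M" using f by auto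
  have subalg: "subalgebra M (invariant_algebra F M T)"
    by (rule subalgebra_invariant_algebra[OF action])
  have "(\<lambda>j. \<integral>\<^sup>+ x. ennreal \<bar>f x - t j x\<bar> \<partial>M) \<longlonglongrightarrow> 0"
    unfolding t_def by (rule truncation_tendsto_L1[OF f])
  then have "\<forall>\<^sub>F j in sequentially. (\<integral>\<^sup>+ x. ennreal \<bar>f x - t j x\<bar> \<partial>M) < ennreal (d / 3)"
    by (rule order_tendstoD(2)) (use d in auto)
  then obtain j where j: "(\<integral>\<^sup>+ x. ennreal \<bar>f x - t j x\<bar> \<partial>M) < ennreal (d / 3)"
    by (auto simp: eventually_sequentially)
  define g where "g = t j"
  have g_meas [measurable]: "g \<in> borel_measurable M"
    unfolding g_def t_def[abs_def] by measurable
  have g_bound: "\<bar>g x\<bar> \<le> real j" for x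
    by (auto simp: g_def t_def)
  have g: "integrable M g"
    using g_bound by (intro integrable_const_bound[of _ "real j"]) auto
  have fg: "(\<integral>\<^sup>+ x. ennreal \<bar>f x - g x\<bar> \<partial>M) < ennreal (d / 3)"
    using j by (simp add: g_def)
  have gf: "(\<integral>\<^sup>+ x. ennreal \<bar>g x - f x\<bar> \<partial>M) < ennreal (d / 3)"
    using fg by (simp add: abs_minus_commute)
  have \<theta>_meas [measurable]: "\<theta> h n \<in> borel_measurable M" if "h \<in> borel_measurable M" for h n
  proof -
    have [measurable]: "(markov ^^ (n + i)) (\<lambda>_. h) v \<in> borel_measurable M" if "v \<in> V" for i v
      using \<open>h \<in> borel_measurable M\<close> that by (intro markov_pow_measurable)
    show ?thesis
      unfolding \<theta>_def[abs_def] markov_pow_window_average by measurable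
  qed
  have [measurable]: "E h \<in> borel_measurable M" for h
    unfolding E_def by simp
  have le: "?D n \<le> (\<integral>\<^sup>+ x. ennreal \<bar>f x - g x\<bar> \<partial>M) + (\<integral>\<^sup>+ x. ennreal \<bar>\<theta> g n x - E g x\<bar> \<partial>M)
      + (\<integral>\<^sup>+ x. ennreal \<bar>g x - f x\<bar> \<partial>M)" for n
  proof -
    have "?D n \<le> (\<integral>\<^sup>+ x. (ennreal \<bar>\<theta> f n x - \<theta> g n x\<bar> + ennreal \<bar>\<theta> g n x - E g x\<bar>)
        + ennreal \<bar>E g x - E f x\<bar> \<partial>M)"
    proof (rule nn_integral_mono)
      fix x
      have "\<bar>\<theta> f n x - E f x\<bar> \<le> \<bar>\<theta> f n x - \<theta> g n x\<bar> + \<bar>\<theta> g n x - E g x\<bar> + \<bar>E g x - E f x\<bar>"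
        by linarith
      then show "ennreal \<bar>(\<Sum>v\<in>V. \<nu> v * (markov ^^ n) (window_average (2 * k) f) v x)
          - real_cond_exp M (invariant_algebra F M T) f x\<bar>
          \<le> ennreal \<bar>\<theta> f n x - \<theta> g n x\<bar> + ennreal \<bar>\<theta> g n x - E g x\<bar> + ennreal \<bar>E g x - E f x\<bar>"
        by (simp add: \<theta>_def E_def ennreal_plus[symmetric] ennreal_leI del: ennreal_plus)
    qed
    also have "\<dots> = (\<integral>\<^sup>+ x. ennreal \<bar>\<theta> f n x - \<theta> g n x\<bar> \<partial>M)
        + (\<integral>\<^sup>+ x. ennreal \<bar>\<theta> g n x - E g x\<bar> \<partial>M) + (\<integral>\<^sup>+ x. ennreal \<bar>E g x - E f x\<bar> \<partial>M)"
      by (simp add: nn_integral_add)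
    also have "\<dots> \<le> (\<integral>\<^sup>+ x. ennreal \<bar>f x - g x\<bar> \<partial>M) + (\<integral>\<^sup>+ x. ennreal \<bar>\<theta> g n x - E g x\<bar> \<partial>M)
        + (\<integral>\<^sup>+ x. ennreal \<bar>g x - f x\<bar> \<partial>M)"
      unfolding \<theta>_def E_def using k
      by (intro add_mono order_refl mean_window_L1_contraction[OF f g]
          real_cond_exp_L1_contraction[OF subalg g f]) simp
    finally show ?thesis .
  qed
  have "(\<lambda>n. \<integral>\<^sup>+ x. ennreal \<bar>\<theta> g n x - E g x\<bar> \<partial>M) \<longlonglongrightarrow> 0"
    unfolding \<theta>_def E_def
    by (rule bounded_window_converges[OF assms(1) k countable g_meas g_bound])
  then have "\<forall>\<^sub>F n in sequentially. (\<integral>\<^sup>+ x. ennreal \<bar>\<theta> g n x - E g x\<bar> \<partial>M) < ennreal (d / 3)"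
    by (rule order_tendstoD(2)) (use d in auto)
  then show "\<forall>\<^sub>F n in sequentially. ?D n < e"
  proof eventually_elim
    case (elim n)
    have "?D n \<le> ennreal (d / 3) + ennreal (d / 3) + ennreal (d / 3)"
      using le[of n] add_mono[OF add_mono[OF less_imp_le[OF fg] less_imp_le[OF elim]] less_imp_le[OF gf]]
      by (rule order_trans)
    also have "\<dots> = ennreal d"
      using d by (simp add: ennreal_plus[symmetric] del: ennreal_plus)
    finally show ?case using d(2) by (rule order_le_less_trans)
  qed
qed auto

end

section \<open>Mean convergence of spherical averages\<close>

theorem theorem1p1:
  fixes F :: "('g, 'm) monoid_scheme"
    and V :: "'v set"
    and L :: "'v \<Rightarrow> 'g"
    and P :: "'v \<Rightarrow> 'v \<Rightarrow> real"
    and \<nu> :: "'v \<Rightarrow> real"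
    and k :: nat
    and M :: "'x measure"
    and T :: "'g \<Rightarrow> 'x \<Rightarrow> 'x"
    and f :: "'x \<Rightarrow> real"
  assumes "free_group F" and "finitely_generated_group F"
    and "finite V"
    and "L \<in> V \<rightarrow> carrier F"
    and "stochastic_matrix V P"
    and "stationary_distribution V P \<nu>"
    and "\<forall>v\<in>V. \<nu> v > 0"
    and "k \<ge> 1"
    and "admissible F V L P k"
    and "pmp_action F M T"
    and "integrable M f"
  shows "(\<lambda>n. \<integral>\<^sup>+ x. ennreal \<bar>1 / (2 * real k) *
                 (\<Sum>i = 0..2 * k - 1. spherical_average F V L P \<nu> T (n + i) f x)
               - real_cond_exp M (invariant_algebra F M T) f x\<bar> \<partial>M)
         \<longlonglongrightarrow> 0"
proof -
  have group: "group F"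
    using assms(2) by (simp add: finitely_generated_group_def)
  have "prob_space M"
    using assms(10) by (simp add: pmp_action_def)
  then interpret labelled_random_walk M V P \<nu> F L T
    using assms group pmp_action_measurable[OF group assms(10)] pmp_action_distr[OF group assms(10)]
    by (intro labelled_random_walk.intro stationary_random_maps.intro
        stationary_random_maps_axioms.intro labelled_random_walk_axioms.intro) auto
  have window: "1 / (2 * real k) * (\<Sum>i = 0..2 * k - 1. spherical_average F V L P \<nu> T (n + i) f x)
      = (\<Sum>v\<in>V. \<nu> v * (markov ^^ n) (window_average (2 * k) f) v x)" if "n \<ge> 1" "x \<in> space M" for n x
    using spherical_window_eq_markov[OF that(1) _ that(2), of "2 * k" f] assms(8) by simp
  \<comment> \<open>For \<open>n = 0\<close> the spherical average refers to the last vertex of the empty path, so the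
    identity is used from \<open>n = 1\<close> on.\<close>
  have "\<forall>\<^sub>F n in sequentially.
      (\<integral>\<^sup>+ x. ennreal \<bar>(\<Sum>v\<in>V. \<nu> v * (markov ^^ n) (window_average (2 * k) f) v x)
           - real_cond_exp M (invariant_algebra F M T) f x\<bar> \<partial>M)
      = (\<integral>\<^sup>+ x. ennreal \<bar>1 / (2 * real k) *
                 (\<Sum>i = 0..2 * k - 1. spherical_average F V L P \<nu> T (n + i) f x)
               - real_cond_exp M (invariant_algebra F M T) f x\<bar> \<partial>M)"
    using eventually_ge_at_top[of 1]
    by eventually_elim (rule nn_integral_cong, simp only: window)
  from Lim_transform_eventually[OF integrable_window_converges[OF assms(9,8)
        countable_carrier_if_finitely_generated[OF assms(2)] assms(11)] this]
  show ?thesis .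
qed

end
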